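(* Let $G$ be a unique product monoid and $S=R*G$ a crossed product. Let $M$ be a nonzero right $R$-module. Suppose that $R$ satisfies the ascending chain condition on (two-sided) ideals and $\sigma$ is pointwise surjective. Then the following conditions are equivalent. (1) $M$ is $S$-prime, i.e. the right $S$-module $M\otimes_R S$ is prime. (2) If $m\in M$, $b\in R$, and $mRb^h=0$ for all $h\in G$, then either $m=0$ or $Mb=0$. (3) If $m\in M$ and $B$ is a $G$-invariant ideal of $R$ with $mB=0$, then $m=0$ or $MB=0$. (4) $(\operatorname{ann} N:G)=(\operatorname{ann} M:G)$ for every nonzero submodule $N$ of $M$.
   Context: Rings have $1$, modules are unital right modules, ideals are two-sided. A unique product monoid is a monoid $G$ (identity $e$) such that whenever $X,Y$ are nonempty finite subsets of $G$, there exist $x\in X$, $y\in Y$ with $xy\ne x'y'$ for every pair $(x',y')\in X\times Y$ different from $(x,y)$. A crossed product $S=R*G$ is determined by a ring $R$, a monoid $G$, and functions $\sigma:G\to\operatorname{End}_{\mathrm{Ring}}(R)$ and $c:G\times G\to GL_1(R)$ (units of $R$); write $r^g=\sigma(g)(r)$. $S=\bigoplus_{g\in G}R\overline{g}$ is a free left $R$-module with basis $\{\overline g:g\in G\}$ and multiplication determined by $\overline g\, r=r^g\,\overline g$ and $\overline g\,\overline h=c(g,h)\overline{gh}$, where for all $r\in R$, $g,h,i\in G$: $r^e=r$; $c(g,e)=c(e,g)=1$; $(r^h)^g c(g,h)=c(g,h)r^{gh}$; $c(g,h)c(gh,i)=c(h,i)^g c(g,hi)$. $R$ is identified with $R\overline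 e$. $\sigma$ is pointwise surjective if $\sigma(g)$ is surjective for all $g\in G$. An ideal $I$ of $R$ is $G$-invariant if $\sigma(g)^{-1}(I)=I$ for all $g\in G$. $(X:G)=\{r\in R: r^g\in X\text{ for all }g\in G\}$ for $X\subseteq R$. $\operatorname{ann} N=\{r\in R:Nr=0\}$. A nonzero module is prime if all its nonzero submodules have the same annihilator as the module itself. *)

theory Defs
  imports "HOL-Algebra.Module" "HOL-Algebra.Ideal" "HOL-Algebra.Free_Abelian_Groups"
begin

section \<open>Right modules\<close>

text \<open>
  The record of HOL-Algebra modules is reused for right modules:
  the field \<^const>\<open>smult\<close> applied to \<open>a\<close> and \<open>x\<close> stands for \<open>x a\<close>,
  and is written \<open>x \<star>\<^bsub>M\<^esub> a\<close>. The library locale \<^locale>\<open>submodule\<close> (an additive subgroup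
  closed under \<^const>\<open>smult\<close>) makes no commutativity assumption and is used as it stands.
\<close>

abbreviation rsmult :: "[('a, 'b, 'm) module_scheme, 'b, 'a] \<Rightarrow> 'b" (infixl \<open>\<star>\<index>\<close> 70)
  where "x \<star>\<^bsub>M\<^esub> a \<equiv> a \<odot>\<^bsub>M\<^esub> x"

locale right_module = R?: ring R + M?: abelian_group M
  for R :: "('a, 'p) ring_scheme" (structure) and M :: "('a, 'b, 'm) module_scheme" (structure) +
  assumes rsmult_closed [simp, intro]:
      "\<lbrakk>x \<in> carrier M; a \<in> carrier R\<rbrakk> \<Longrightarrow> x \<star>\<^bsub>M\<^esub> a \<in> carrier M"
    and rsmult_add_scalar:
      "\<lbrakk>x \<in> carrier M; a \<in> carrier R; b \<in> carrier R\<rbrakk> \<Longrightarrow>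
        x \<star>\<^bsub>M\<^esub> (a \<oplus>\<^bsub>R\<^esub> b) = x \<star>\<^bsub>M\<^esub> a \<oplus>\<^bsub>M\<^esub> x \<star>\<^bsub>M\<^esub> b"
    and rsmult_add_vector:
      "\<lbrakk>x \<in> carrier M; y \<in> carrier M; a \<in> carrier R\<rbrakk> \<Longrightarrow>
        (x \<oplus>\<^bsub>M\<^esub> y) \<star>\<^bsub>M\<^esub> a = x \<star>\<^bsub>M\<^esub> a \<oplus>\<^bsub>M\<^esub> y \<star>\<^bsub>M\<^esub> a"
    and rsmult_assoc:
      "\<lbrakk>x \<in> carrier M; a \<in> carrier R; b \<in> carrier R\<rbrakk> \<Longrightarrow>
        x \<star>\<^bsub>M\<^esub> (a \<otimes>\<^bsub>R\<^esub> b) = (x \<star>\<^bsub>M\<^esub> a) \<star>\<^bsub>M\<^esub> b"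
    and rsmult_one [simp]: "x \<in> carrier M \<Longrightarrow> x \<star>\<^bsub>M\<^esub> \<one>\<^bsub>R\<^esub> = x"

definition ann :: "('a, 'p) ring_scheme \<Rightarrow> ('a, 'b, 'm) module_scheme \<Rightarrow> 'b set \<Rightarrow> 'a set"
  where "ann R M N = {r \<in> carrier R. \<forall>x\<in>N. x \<star>\<^bsub>M\<^esub> r = \<zero>\<^bsub>M\<^esub>}"

locale prime_module = right_module +
  assumes nonzero: "carrier M \<noteq> {\<zero>\<^bsub>M\<^esub>}"
    and ann_eq: "\<lbrakk>submodule N R M; N \<noteq> {\<zero>\<^bsub>M\<^esub>}\<rbrakk> \<Longrightarrow> ann R M N = ann R M (carrier M)"

definition acc_ideals :: "('a, 'p) ring_scheme \<Rightarrow> bool"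
  where "acc_ideals R \<longleftrightarrow>
    (\<forall>I :: nat \<Rightarrow> 'a set. (\<forall>n. ideal (I n) R) \<and> (\<forall>n. I n \<subseteq> I (Suc n)) \<longrightarrow>
      (\<exists>N. \<forall>n\<ge>N. I n = I N))"


section \<open>Extension of scalars\<close>

text \<open>
  The module \<open>M \<otimes>\<^sub>R S\<close>, where \<open>S\<close> is a left \<open>R\<close>-module through a ring homomorphism
  \<open>\<phi> : R \<rightarrow> S\<close>: the free abelian group on \<open>M \<times> S\<close> modulo the subgroup generated by the
  usual relations.
\<close>

definition tensor_relations ::
    "('r, 'p) ring_scheme \<Rightarrow> ('s, 'q) ring_scheme \<Rightarrow> ('r \<Rightarrow> 's) \<Rightarrow> ('r, 'm, 'k) module_scheme
      \<Rightarrow> ('m \<times> 's \<Rightarrow>\<^sub>0 int) set"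
  where "tensor_relations R S \<phi> M =
    {frag_of (x \<oplus>\<^bsub>M\<^esub> y, s) - frag_of (x, s) - frag_of (y, s) | x y s.
       x \<in> carrier M \<and> y \<in> carrier M \<and> s \<in> carrier S} \<union>
    {frag_of (x, s \<oplus>\<^bsub>S\<^esub> t) - frag_of (x, s) - frag_of (x, t) | x s t.
       x \<in> carrier M \<and> s \<in> carrier S \<and> t \<in> carrier S} \<union>
    {frag_of (x \<star>\<^bsub>M\<^esub> r, s) - frag_of (x, \<phi> r \<otimes>\<^bsub>S\<^esub> s) | x r s.
       x \<in> carrier M \<and> r \<in> carrier R \<and> s \<in> carrier S}"

text \<open>
  Elements of \<open>M \<otimes>\<^sub>R S\<close> are cosets; \<open>t \<in> S\<close> acts by \<open>(x \<otimes> s) t = x \<otimes> s t\<close>, extended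
  additively to formal sums. The union in the scalar action is over cosets that all coincide.
  The fields \<^const>\<open>monoid.mult\<close> and \<^const>\<open>monoid.one\<close> of the module record are irrelevant.
\<close>

definition extend_scalars ::
    "('r, 'p) ring_scheme \<Rightarrow> ('s, 'q) ring_scheme \<Rightarrow> ('r \<Rightarrow> 's) \<Rightarrow> ('r, 'm, 'k) module_scheme
      \<Rightarrow> ('s, ('m \<times> 's \<Rightarrow>\<^sub>0 int) set) module"
  where "extend_scalars R S \<phi> M =
    (let F = free_Abelian_group (carrier M \<times> carrier S);
         H = generate F (tensor_relations R S \<phi> M)
     in \<lparr>carrier = carrier (F Mod H),
         monoid.mult = undefined, one = undefined,
         ring.zero = \<one>\<^bsub>F Mod H\<^esub>,
         ring.add = monoid.mult (F Mod H),
         smult = (\<lambda>t U. \<Union>u\<in>U. H #>\<^bsub>F\<^esub> frag_extend (\<lambda>(x, s). frag_of (x, s \<otimes>\<^bsub>S\<^esub> t)) u)\<rparr>)"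


section \<open>Crossed products\<close>

locale unique_product_monoid = monoid G for G (structure) +
  assumes unique_product:
    "\<lbrakk>A \<subseteq> carrier G; B \<subseteq> carrier G; finite A; finite B; A \<noteq> {}; B \<noteq> {}\<rbrakk> \<Longrightarrow>
      \<exists>x\<in>A. \<exists>y\<in>B. \<forall>x'\<in>A. \<forall>y'\<in>B. (x', y') \<noteq> (x, y) \<longrightarrow> x \<otimes> y \<noteq> x' \<otimes> y'"

text \<open>The twisted power \<open>r\<^sup>g\<close> is \<open>\<sigma> g r\<close>.\<close>

locale crossed_system = R: ring R + G: monoid G
  for R :: "('r, 'p) ring_scheme" and G :: "('g, 'q) monoid_scheme"
    and \<sigma> :: "'g \<Rightarrow> 'r \<Rightarrow> 'r" and c :: "'g \<Rightarrow> 'g \<Rightarrow> 'r" +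
  assumes sigma_hom: "g \<in> carrier G \<Longrightarrow> \<sigma> g \<in> ring_hom R R"
    and c_unit: "\<lbrakk>g \<in> carrier G; h \<in> carrier G\<rbrakk> \<Longrightarrow> c g h \<in> Units R"
    and sigma_one: "r \<in> carrier R \<Longrightarrow> \<sigma> \<one>\<^bsub>G\<^esub> r = r"
    and c_one_right: "g \<in> carrier G \<Longrightarrow> c g \<one>\<^bsub>G\<^esub> = \<one>\<^bsub>R\<^esub>"
    and c_one_left: "g \<in> carrier G \<Longrightarrow> c \<one>\<^bsub>G\<^esub> g = \<one>\<^bsub>R\<^esub>"
    and sigma_twist:
      "\<lbrakk>r \<in> carrier R; g \<in> carrier G; h \<in> carrier G\<rbrakk> \<Longrightarrow>
        \<sigma> g (\<sigma> h r) \<otimes>\<^bsub>R\<^esub> c g h = c g h \<otimes>\<^bsub>R\<^esub> \<sigma> (g \<otimes>\<^bsub>G\<^esub> h) r"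
    and cocycle:
      "\<lbrakk>g \<in> carrier G; h \<in> carrier G; i \<in> carrier G\<rbrakk> \<Longrightarrow>
        c g h \<otimes>\<^bsub>R\<^esub> c (g \<otimes>\<^bsub>G\<^esub> h) i = \<sigma> g (c h i) \<otimes>\<^bsub>R\<^esub> c g (h \<otimes>\<^bsub>G\<^esub> i)"

text \<open>The element \<open>r g\<close> of the crossed product, where \<open>g\<close> denotes a basis element.\<close>

definition cp_single ::
    "('r, 'p) ring_scheme \<Rightarrow> ('g, 'q) monoid_scheme \<Rightarrow> 'r \<Rightarrow> 'g \<Rightarrow> 'g \<Rightarrow> 'r"
  where "cp_single R G r g = (\<lambda>h\<in>carrier G. if h = g then r else \<zero>\<^bsub>R\<^esub>)"

text \<open>
  An element is its family of left coefficients, a finitely supported function on \<open>G\<close>.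
  The product is the biadditive extension of
  \<open>(r g) (r' h) = (r \<otimes> \<sigma> g r' \<otimes> c g h) (g h)\<close>; see \<open>cp_single_mult\<close> below.
\<close>

definition crossed_product ::
    "('r, 'p) ring_scheme \<Rightarrow> ('g, 'q) monoid_scheme \<Rightarrow> ('g \<Rightarrow> 'r \<Rightarrow> 'r) \<Rightarrow> ('g \<Rightarrow> 'g \<Rightarrow> 'r)
      \<Rightarrow> ('g \<Rightarrow> 'r) ring"
  where "crossed_product R G \<sigma> c =
    \<lparr>carrier = {s \<in> carrier G \<rightarrow>\<^sub>E carrier R. finite {g \<in> carrier G. s g \<noteq> \<zero>\<^bsub>R\<^esub>}},
     monoid.mult = (\<lambda>s t. \<lambda>k\<in>carrier G.
       finsum R (\<lambda>(g, h). s g \<otimes>\<^bsub>R\<^esub> \<sigma> g (t h) \<otimes>\<^bsub>R\<^esub> c g h)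
         {(g, h). g \<in> carrier G \<and> h \<in> carrier G \<and> g \<otimes>\<^bsub>G\<^esub> h = k
            \<and> s g \<noteq> \<zero>\<^bsub>R\<^esub> \<and> t h \<noteq> \<zero>\<^bsub>R\<^esub>}),
     one = cp_single R G \<one>\<^bsub>R\<^esub> \<one>\<^bsub>G\<^esub>,
     ring.zero = (\<lambda>g\<in>carrier G. \<zero>\<^bsub>R\<^esub>),
     ring.add = (\<lambda>s t. \<lambda>g\<in>carrier G. s g \<oplus>\<^bsub>R\<^esub> t g)\<rparr>"

lemma (in crossed_system) cp_single_mult:
  assumes "r \<in> carrier R" "r' \<in> carrier R" "g \<in> carrier G" "h \<in> carrier G"
  shows "cp_single R G r g \<otimes>\<^bsub>crossed_product R G \<sigma> c\<^esub> cp_single R G r' h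
    = cp_single R G (r \<otimes>\<^bsub>R\<^esub> \<sigma> g r' \<otimes>\<^bsub>R\<^esub> c g h) (g \<otimes>\<^bsub>G\<^esub> h)"
proof -
  have cl: "\<sigma> g r' \<in> carrier R" "c g h \<in> carrier R" "\<sigma> g \<zero>\<^bsub>R\<^esub> = \<zero>\<^bsub>R\<^esub>"
    using assms sigma_hom[of g] c_unit[of g h] ring_hom_zero[OF sigma_hom R.ring_axioms R.ring_axioms]
    by (auto simp: ring_hom_def Units_def)
  have "finsum R
        (\<lambda>(g', h'). cp_single R G r g g' \<otimes>\<^bsub>R\<^esub> \<sigma> g' (cp_single R G r' h h') \<otimes>\<^bsub>R\<^esub> c g' h')
        {(g', h'). g' \<in> carrier G \<and> h' \<in> carrier G \<and> g' \<otimes>\<^bsub>G\<^esub> h' = k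
            \<and> cp_single R G r g g' \<noteq> \<zero>\<^bsub>R\<^esub> \<and> cp_single R G r' h h' \<noteq> \<zero>\<^bsub>R\<^esub>}
      = (if k = g \<otimes>\<^bsub>G\<^esub> h then r \<otimes>\<^bsub>R\<^esub> \<sigma> g r' \<otimes>\<^bsub>R\<^esub> c g h else \<zero>\<^bsub>R\<^esub>)"
    (is "finsum R ?f ?A = _") if "k \<in> carrier G" for k
  proof (cases "r = \<zero>\<^bsub>R\<^esub> \<or> r' = \<zero>\<^bsub>R\<^esub> \<or> k \<noteq> g \<otimes>\<^bsub>G\<^esub> h")
    case True
    then have A: "?A = {}"
      by (auto simp: cp_single_def split: if_splits)
    show ?thesis
      unfolding A using True cl assms by auto
  next
    case False
    then have A: "?A = {(g, h)}"
      using assms by (auto simp: cp_single_def split: if_splits)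
    show ?thesis
      unfolding A using False cl assms by (simp add: cp_single_def)
  qed
  then show ?thesis
    by (auto simp: crossed_product_def cp_single_def[of R G _ "g \<otimes>\<^bsub>G\<^esub> h"] fun_eq_iff)
qed

definition induced_module ::
    "('r, 'p) ring_scheme \<Rightarrow> ('g, 'q) monoid_scheme \<Rightarrow> ('g \<Rightarrow> 'r \<Rightarrow> 'r) \<Rightarrow> ('g \<Rightarrow> 'g \<Rightarrow> 'r)
      \<Rightarrow> ('r, 'm, 'k) module_scheme \<Rightarrow> ('g \<Rightarrow> 'r, ('m \<times> ('g \<Rightarrow> 'r) \<Rightarrow>\<^sub>0 int) set) module"
  where "induced_module R G \<sigma> c M =
    extend_scalars R (crossed_product R G \<sigma> c) (\<lambda>r. cp_single R G r \<one>\<^bsub>G\<^esub>) M"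

definition S_prime ::
    "('r, 'p) ring_scheme \<Rightarrow> ('g, 'q) monoid_scheme \<Rightarrow> ('g \<Rightarrow> 'r \<Rightarrow> 'r) \<Rightarrow> ('g \<Rightarrow> 'g \<Rightarrow> 'r)
      \<Rightarrow> ('r, 'm, 'k) module_scheme \<Rightarrow> bool"
  where "S_prime R G \<sigma> c M \<longleftrightarrow>
    prime_module (crossed_product R G \<sigma> c) (induced_module R G \<sigma> c M)"

definition pointwise_surjective ::
    "('r, 'p) ring_scheme \<Rightarrow> ('g, 'q) monoid_scheme \<Rightarrow> ('g \<Rightarrow> 'r \<Rightarrow> 'r) \<Rightarrow> bool"
  where "pointwise_surjective R G \<sigma> \<longleftrightarrow> (\<forall>g\<in>carrier G. \<sigma> g ` carrier R = carrier R)"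

definition G_invariant ::
    "('r, 'p) ring_scheme \<Rightarrow> ('g, 'q) monoid_scheme \<Rightarrow> ('g \<Rightarrow> 'r \<Rightarrow> 'r) \<Rightarrow> 'r set \<Rightarrow> bool"
  where "G_invariant R G \<sigma> I \<longleftrightarrow> (\<forall>g\<in>carrier G. {r \<in> carrier R. \<sigma> g r \<in> I} = I)"

definition G_core ::
    "('r, 'p) ring_scheme \<Rightarrow> ('g, 'q) monoid_scheme \<Rightarrow> ('g \<Rightarrow> 'r \<Rightarrow> 'r) \<Rightarrow> 'r set \<Rightarrow> 'r set"
  where "G_core R G \<sigma> A = {r \<in> carrier R. \<forall>g\<in>carrier G. \<sigma> g r \<in> A}"

end

theory Submission
  imports Defs "HOL-Algebra.RingHom"
begin

text \<open>
  As a right \<open>S\<close>-module, \<open>M \<otimes>\<^sub>R S\<close> is the module of finitely supported functions \<open>G \<rightarrow> M\<close>.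
  If it is prime and \<open>m R b\<^sup>h = 0\<close> for all \<open>h\<close>, then \<open>b\<close> annihilates \<open>(m \<otimes> 1) S\<close>, hence all of
  \<open>M \<otimes>\<^sub>R S\<close>; this gives (2). Condition (2) says that, for \<open>m \<noteq> 0\<close>, the ideal
  \<open>(ann (m R) : G)\<close> annihilates \<open>M\<close>, which is (4); and (3) is equivalent because an ideal that is
  mapped into itself by all \<open>\<sigma> g\<close> is \<open>G\<close>-invariant, by surjectivity and the ascending chain
  condition.

  For (3) implies (1), let \<open>s\<close> annihilate a submodule \<open>N \<noteq> 0\<close> and choose \<open>f \<noteq> 0\<close> in \<open>N\<close> of minimal
  support. All the nonzero elements \<open>f k\<close> with \<open>k\<close> in the basis \<open>G\<close> also have minimal support, and
  unique products yield \<open>f k R s\<^sub>h = 0\<close> for every coefficient \<open>s\<^sub>h\<close>. So, for \<open>g\<close> in the support of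
  \<open>f\<close>, all \<open>s\<^sub>h\<close> lie in the ideal of those \<open>b\<close> with \<open>f\<^sub>g R b\<^sup>g\<^sup>k = 0\<close> for all \<open>k\<close>. It is
  \<open>G\<close>-invariant and annihilates \<open>f\<^sub>g\<close>, hence it annihilates \<open>M\<close>, and \<open>s\<close> annihilates \<open>M \<otimes>\<^sub>R S\<close>.
\<close>

section \<open>Right modules\<close>

context right_module
begin

lemma rsmult_zero_vector [simp]:
  assumes "a \<in> carrier R" shows "\<zero>\<^bsub>M\<^esub> \<star>\<^bsub>M\<^esub> a = \<zero>\<^bsub>M\<^esub>"
proof -
  have "\<zero>\<^bsub>M\<^esub> \<star>\<^bsub>M\<^esub> a \<oplus>\<^bsub>M\<^esub> \<zero>\<^bsub>M\<^esub> \<star>\<^bsub>M\<^esub> a = \<zero>\<^bsub>M\<^esub> \<star>\<^bsub>M\<^esub> a"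
    using rsmult_add_vector[of "\<zero>\<^bsub>M\<^esub>" "\<zero>\<^bsub>M\<^esub>" a] assms by simp
  then show ?thesis
    using assms by (metis M.add.r_cancel_one' M.zero_closed rsmult_closed)
qed

lemma rsmult_zero_scalar [simp]:
  assumes "x \<in> carrier M" shows "x \<star>\<^bsub>M\<^esub> \<zero>\<^bsub>R\<^esub> = \<zero>\<^bsub>M\<^esub>"
proof -
  have "x \<star>\<^bsub>M\<^esub> \<zero>\<^bsub>R\<^esub> \<oplus>\<^bsub>M\<^esub> x \<star>\<^bsub>M\<^esub> \<zero>\<^bsub>R\<^esub> = x \<star>\<^bsub>M\<^esub> \<zero>\<^bsub>R\<^esub>"
    using rsmult_add_scalar[of x "\<zero>\<^bsub>R\<^esub>" "\<zero>\<^bsub>R\<^esub>"] assms by simp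
  then show ?thesis
    using assms by (metis M.add.r_cancel_one' R.zero_closed rsmult_closed)
qed

lemma rsmult_minus_vector:
  assumes "x \<in> carrier M" "a \<in> carrier R" shows "(\<ominus>\<^bsub>M\<^esub> x) \<star>\<^bsub>M\<^esub> a = \<ominus>\<^bsub>M\<^esub> (x \<star>\<^bsub>M\<^esub> a)"
  using rsmult_add_vector[of x "\<ominus>\<^bsub>M\<^esub> x" a] assms
  by (metis M.add.inv_closed M.minus_equality M.r_neg M.a_comm rsmult_closed rsmult_zero_vector)

lemma rsmult_minus_scalar:
  assumes "x \<in> carrier M" "a \<in> carrier R" shows "x \<star>\<^bsub>M\<^esub> (\<ominus>\<^bsub>R\<^esub> a) = \<ominus>\<^bsub>M\<^esub> (x \<star>\<^bsub>M\<^esub> a)"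
  using rsmult_add_scalar[of x a "\<ominus>\<^bsub>R\<^esub> a"] assms
  by (metis R.add.inv_closed M.minus_equality R.r_neg M.a_comm rsmult_closed rsmult_zero_scalar)

text \<open>The values \<open>c g h\<close> are units, so this cancels them from equations in
  \<open>M\<close>.\<close>

lemma rsmult_unit_eq_zero:
  assumes "x \<in> carrier M" "u \<in> Units R" "x \<star>\<^bsub>M\<^esub> u = \<zero>\<^bsub>M\<^esub>" shows "x = \<zero>\<^bsub>M\<^esub>"
proof -
  obtain v where v: "v \<in> carrier R" "u \<otimes>\<^bsub>R\<^esub> v = \<one>\<^bsub>R\<^esub>"
    using assms R.Units_r_inv_ex by blast
  have "x = x \<star>\<^bsub>M\<^esub> (u \<otimes>\<^bsub>R\<^esub> v)"
    using v assms by simp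
  also have "\<dots> = \<zero>\<^bsub>M\<^esub>"
    using v assms by (subst rsmult_assoc) (auto intro: R.Units_closed)
  finally show ?thesis .
qed

text \<open>Applied both to \<open>M\<close> and to the model of the induced module, where it
  supplies the submodule on which (4) or (1) is tested.\<close>

lemma submodule_cyclic:
  assumes "x \<in> carrier M"
  shows "submodule ((\<lambda>a. x \<star>\<^bsub>M\<^esub> a) ` carrier R) R M"
proof (intro submodule.intro submodule_axioms.intro M.add.subgroupI)
  show "\<ominus>\<^bsub>M\<^esub> y \<in> (\<lambda>a. x \<star>\<^bsub>M\<^esub> a) ` carrier R" if "y \<in> (\<lambda>a. x \<star>\<^bsub>M\<^esub> a) ` carrier R" for y
    using that assms by (auto simp flip: rsmult_minus_scalar)
qed (use assms in \<open>auto simp flip: rsmult_add_scalar rsmult_assoc\<close>)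

end

text \<open>\<open>R\<close> as a right module over itself. What is proved for the model over a
  general \<open>M\<close> specializes to it, and most ring axioms of the crossed product come from
  this specialization.\<close>

definition regular_module :: "('r, 'p) ring_scheme \<Rightarrow> ('r, 'r) module"
  where "regular_module R = \<lparr>carrier = carrier R, monoid.mult = undefined, one = undefined,
    ring.zero = \<zero>\<^bsub>R\<^esub>, ring.add = (\<oplus>\<^bsub>R\<^esub>), smult = (\<lambda>a x. x \<otimes>\<^bsub>R\<^esub> a)\<rparr>"

lemma regular_module_simps [simp]:
  "carrier (regular_module R) = carrier R"
  "\<zero>\<^bsub>regular_module R\<^esub> = \<zero>\<^bsub>R\<^esub>"
  "x \<star>\<^bsub>regular_module R\<^esub> a = x \<otimes>\<^bsub>R\<^esub> a"
  by (simp_all add: regular_module_def)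

lemma add_regular_module [simp]: "(\<oplus>\<^bsub>regular_module R\<^esub>) = (\<oplus>\<^bsub>R\<^esub>)"
  by (simp add: regular_module_def)

lemma finsum_regular_module [simp]: "finsum (regular_module R) f A = finsum R f A"
  by (simp add: finsum_def finprod_def)

lemma (in ring) right_module_regular: "right_module R (regular_module R)"
proof (intro right_module.intro right_module_axioms.intro)
  show "abelian_group (regular_module R)"
    by (rule abelian_groupI) (auto simp: a_ac intro: l_neg a_inv_closed)
qed (use ring_axioms in \<open>auto simp: l_distr r_distr m_assoc\<close>)

section \<open>Finitely supported functions as a module over the crossed product\<close>

text \<open>
  The concrete model of \<open>M \<otimes>\<^sub>R S\<close>: a function \<open>f\<close> stands for the sum of the elements
  \<open>f g \<otimes> g\<close>, and \<open>cp_single M G m g\<close> for \<open>m \<otimes> g\<close>.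
\<close>

definition cp_module ::
    "('r, 'p) ring_scheme \<Rightarrow> ('g, 'q) monoid_scheme \<Rightarrow> ('g \<Rightarrow> 'r \<Rightarrow> 'r) \<Rightarrow> ('g \<Rightarrow> 'g \<Rightarrow> 'r)
      \<Rightarrow> ('r, 'm, 'k) module_scheme \<Rightarrow> ('g \<Rightarrow> 'r, 'g \<Rightarrow> 'm) module"
  where "cp_module R G \<sigma> c M =
    \<lparr>carrier = {f \<in> carrier G \<rightarrow>\<^sub>E carrier M. finite {g \<in> carrier G. f g \<noteq> \<zero>\<^bsub>M\<^esub>}},
     monoid.mult = undefined, one = undefined,
     ring.zero = (\<lambda>g\<in>carrier G. \<zero>\<^bsub>M\<^esub>),
     ring.add = (\<lambda>f f'. \<lambda>g\<in>carrier G. f g \<oplus>\<^bsub>M\<^esub> f' g),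
     smult = (\<lambda>s f. \<lambda>k\<in>carrier G.
       finsum M (\<lambda>(g, h). f g \<star>\<^bsub>M\<^esub> (\<sigma> g (s h) \<otimes>\<^bsub>R\<^esub> c g h))
         {(g, h). g \<in> carrier G \<and> h \<in> carrier G \<and> g \<otimes>\<^bsub>G\<^esub> h = k
            \<and> f g \<noteq> \<zero>\<^bsub>M\<^esub> \<and> s h \<noteq> \<zero>\<^bsub>R\<^esub>})\<rparr>"

locale crossed_module = crossed_system R G \<sigma> c + M?: right_module R M
  for R :: "('r, 'p) ring_scheme" and G :: "('g, 'q) monoid_scheme"
    and \<sigma> :: "'g \<Rightarrow> 'r \<Rightarrow> 'r" and c :: "'g \<Rightarrow> 'g \<Rightarrow> 'r"
    and M :: "('r, 'm, 'k) module_scheme"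
begin

abbreviation "S \<equiv> crossed_product R G \<sigma> c"
abbreviation "T \<equiv> cp_module R G \<sigma> c M"

definition supp :: "('g \<Rightarrow> 'm) \<Rightarrow> 'g set"
  where "supp f = {g \<in> carrier G. f g \<noteq> \<zero>\<^bsub>M\<^esub>}"

definition supp_S :: "('g \<Rightarrow> 'r) \<Rightarrow> 'g set"
  where "supp_S s = {g \<in> carrier G. s g \<noteq> \<zero>\<^bsub>R\<^esub>}"

section \<open>Coefficients, supports and the action on finitely supported functions\<close>

lemma sigma_closed [simp]: "\<lbrakk>g \<in> carrier G; r \<in> carrier R\<rbrakk> \<Longrightarrow> \<sigma> g r \<in> carrier R"
  and sigma_add: "\<lbrakk>g \<in> carrier G; r \<in> carrier R; r' \<in> carrier R\<rbrakk> \<Longrightarrow>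
    \<sigma> g (r \<oplus>\<^bsub>R\<^esub> r') = \<sigma> g r \<oplus>\<^bsub>R\<^esub> \<sigma> g r'"
  and sigma_mult: "\<lbrakk>g \<in> carrier G; r \<in> carrier R; r' \<in> carrier R\<rbrakk> \<Longrightarrow>
    \<sigma> g (r \<otimes>\<^bsub>R\<^esub> r') = \<sigma> g r \<otimes>\<^bsub>R\<^esub> \<sigma> g r'"
  and sigma_ring_one [simp]: "g \<in> carrier G \<Longrightarrow> \<sigma> g \<one>\<^bsub>R\<^esub> = \<one>\<^bsub>R\<^esub>"
  using sigma_hom[of g] by (auto simp: ring_hom_def)

lemma sigma_zero [simp]: "g \<in> carrier G \<Longrightarrow> \<sigma> g \<zero>\<^bsub>R\<^esub> = \<zero>\<^bsub>R\<^esub>"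
  using ring_hom_zero[OF sigma_hom R.ring_axioms R.ring_axioms] .

lemma c_closed [simp]: "\<lbrakk>g \<in> carrier G; h \<in> carrier G\<rbrakk> \<Longrightarrow> c g h \<in> carrier R"
  using c_unit by (simp add: R.Units_closed)

lemma T_mem_iff: "f \<in> carrier T \<longleftrightarrow> f \<in> carrier G \<rightarrow>\<^sub>E carrier M \<and> finite (supp f)"
  and T_zero [simp]: "g \<in> carrier G \<Longrightarrow> \<zero>\<^bsub>T\<^esub> g = \<zero>\<^bsub>M\<^esub>"
  and T_add [simp]: "g \<in> carrier G \<Longrightarrow> (f \<oplus>\<^bsub>T\<^esub> f') g = f g \<oplus>\<^bsub>M\<^esub> f' g"
  by (simp_all add: cp_module_def supp_def)

lemma S_mem_iff: "s \<in> carrier S \<longleftrightarrow> s \<in> carrier G \<rightarrow>\<^sub>E carrier R \<and> finite (supp_S s)"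
  and S_zero [simp]: "g \<in> carrier G \<Longrightarrow> \<zero>\<^bsub>S\<^esub> g = \<zero>\<^bsub>R\<^esub>"
  and S_add [simp]: "g \<in> carrier G \<Longrightarrow> (s \<oplus>\<^bsub>S\<^esub> t) g = s g \<oplus>\<^bsub>R\<^esub> t g"
  and S_one: "\<one>\<^bsub>S\<^esub> = cp_single R G \<one>\<^bsub>R\<^esub> \<one>\<^bsub>G\<^esub>"
  by (simp_all add: crossed_product_def supp_S_def)

lemma T_memI:
  assumes "\<And>g. g \<in> carrier G \<Longrightarrow> f g \<in> carrier M" "f \<in> extensional (carrier G)"
    "finite A" "\<And>g. \<lbrakk>g \<in> carrier G; f g \<noteq> \<zero>\<^bsub>M\<^esub>\<rbrakk> \<Longrightarrow> g \<in> A"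
  shows "f \<in> carrier T"
proof -
  have "supp f \<subseteq> A" using assms(4) by (auto simp: supp_def)
  then show ?thesis
    using assms by (auto simp: T_mem_iff PiE_def intro: finite_subset)
qed

text \<open>The type of the values is left free, so the same rule serves for elements of
  \<open>T\<close> and of \<open>S\<close>.\<close>

lemma T_ext:
  assumes "f \<in> extensional (carrier G)" "f' \<in> extensional (carrier G)"
    "\<And>g. g \<in> carrier G \<Longrightarrow> f g = f' g"
  shows "f = f'"
  using assms by (metis extensionalityI)

lemma T_ops_extensional [simp]:
  "\<zero>\<^bsub>T\<^esub> \<in> extensional (carrier G)" "f \<oplus>\<^bsub>T\<^esub> f' \<in> extensional (carrier G)"
  "f \<star>\<^bsub>T\<^esub> s \<in> extensional (carrier G)" "cp_single A G m g \<in> extensional (carrier G)"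
  by (simp_all add: cp_module_def cp_single_def)

lemma T_extensional [simp]: "f \<in> carrier T \<Longrightarrow> f \<in> extensional (carrier G)"
  by (simp add: T_mem_iff PiE_def)

lemma S_ops_extensional [simp]:
  "\<zero>\<^bsub>S\<^esub> \<in> extensional (carrier G)" "s \<oplus>\<^bsub>S\<^esub> t \<in> extensional (carrier G)"
  "s \<otimes>\<^bsub>S\<^esub> t \<in> extensional (carrier G)"
  by (simp_all add: crossed_product_def)

lemma S_extensional [simp]: "f \<in> carrier S \<Longrightarrow> f \<in> extensional (carrier G)"
  by (simp add: S_mem_iff PiE_def)

lemma T_closed [simp]: "\<lbrakk>f \<in> carrier T; g \<in> carrier G\<rbrakk> \<Longrightarrow> f g \<in> carrier M"
  and T_finite [simp]: "f \<in> carrier T \<Longrightarrow> finite (supp f)"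
  by (auto simp: T_mem_iff)

lemma S_closed [simp]: "\<lbrakk>s \<in> carrier S; g \<in> carrier G\<rbrakk> \<Longrightarrow> s g \<in> carrier R"
  and S_finite [simp]: "s \<in> carrier S \<Longrightarrow> finite (supp_S s)"
  by (auto simp: S_mem_iff)

lemma abelian_group_T: "abelian_group T"
proof (rule abelian_groupI)
  show "f \<oplus>\<^bsub>T\<^esub> f' \<in> carrier T" if "f \<in> carrier T" "f' \<in> carrier T" for f f'
  proof (rule T_memI)
    show "finite (supp f \<union> supp f')" using that by simp
  qed (use that in \<open>auto simp: supp_def\<close>)
  show "\<zero>\<^bsub>T\<^esub> \<in> carrier T"
    by (rule T_memI[of _ "{}"]) auto
  show "\<exists>f'\<in>carrier T. f' \<oplus>\<^bsub>T\<^esub> f = \<zero>\<^bsub>T\<^esub>" if f: "f \<in> carrier T" for f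
  proof (intro bexI)
    show "(\<lambda>g\<in>carrier G. \<ominus>\<^bsub>M\<^esub> f g) \<oplus>\<^bsub>T\<^esub> f = \<zero>\<^bsub>T\<^esub>"
      by (rule T_ext) (use f in \<open>auto simp: M.l_neg\<close>)
    show "(\<lambda>g\<in>carrier G. \<ominus>\<^bsub>M\<^esub> f g) \<in> carrier T"
      by (rule T_memI[OF _ _ T_finite[OF f]]) (use f in \<open>auto simp: supp_def\<close>)
  qed
qed (auto intro!: T_ext simp: M.a_ac)

lemma single_T [simp]: "\<lbrakk>m \<in> carrier M; g \<in> carrier G\<rbrakk> \<Longrightarrow> cp_single M G m g \<in> carrier T"
  by (rule T_memI[of _ "{g}"]) (auto simp: cp_single_def split: if_splits)

lemma single_S [simp]: "\<lbrakk>r \<in> carrier R; g \<in> carrier G\<rbrakk> \<Longrightarrow> cp_single R G r g \<in> carrier S"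
  by (auto simp: S_mem_iff cp_single_def supp_S_def simp del: S_finite intro: finite_subset[of _ "{g}"])

lemma single_apply [simp]:
  "h \<in> carrier G \<Longrightarrow> cp_single A G m g h = (if h = g then m else \<zero>\<^bsub>A\<^esub>)"
  by (simp add: cp_single_def)

text \<open>One point of the support is split off at a time, so an additive property need only be
  checked on the elements \<open>cp_single M G m g\<close>.\<close>

lemma T_induct [consumes 1, case_names single add]:
  assumes "f \<in> carrier T"
    and single: "\<And>m g. \<lbrakk>m \<in> carrier M; g \<in> carrier G\<rbrakk> \<Longrightarrow> P (cp_single M G m g)"
    and add: "\<And>f f'. \<lbrakk>f \<in> carrier T; f' \<in> carrier T; P f; P f'\<rbrakk> \<Longrightarrow> P (f \<oplus>\<^bsub>T\<^esub> f')"
  shows "P f"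
  using assms(1)
proof (induction "card (supp f)" arbitrary: f)
  case 0
  then have "supp f = {}" by simp
  \<comment> \<open>The zero function is itself a \<open>cp_single\<close> with coefficient zero,
    which spares a separate base case.\<close>
  then have "f = cp_single M G \<zero>\<^bsub>M\<^esub> \<one>\<^bsub>G\<^esub>"
    using 0 by (intro T_ext) (auto simp: supp_def)
  then show ?case using single by simp
next
  case (Suc n)
  then obtain g where g: "g \<in> supp f"
    by (metis card.empty ex_in_conv nat.distinct(1))
  then have gG: "g \<in> carrier G" by (simp add: supp_def)
  define f' where "f' = (\<lambda>h\<in>carrier G. if h = g then \<zero>\<^bsub>M\<^esub> else f h)"
  have f': "f' \<in> carrier T"
    by (rule T_memI[OF _ _ T_finite[OF Suc(3)]]) (use Suc(3) in \<open>auto simp: f'_def supp_def split: if_splits\<close>)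
  have "supp f' = supp f - {g}"
    by (auto simp: supp_def f'_def)
  then have "card (supp f') = n"
    using Suc g by simp
  then have "P f'"
    using Suc(1) f' by blast
  moreover have "f = cp_single M G (f g) g \<oplus>\<^bsub>T\<^esub> f'"
    by (rule T_ext) (use Suc(3) gG in \<open>auto simp: f'_def\<close>)
  ultimately show ?case
    using add single f' Suc(3) gG by (metis T_closed single_T)
qed

text \<open>The sum that defines the action runs over pairs of nonzero coefficients, an index set
  that changes with \<open>f\<close> and \<open>s\<close>. Any finite set of pairs over
  \<open>k\<close> containing these will do, because the additional terms vanish.\<close>

lemma act_eq_finsum:
  assumes f: "f \<in> carrier T" and s: "s \<in> carrier S" and k: "k \<in> carrier G"
    and fin: "finite A" and A: "A \<subseteq> {(g, h). g \<in> carrier G \<and> h \<in> carrier G \<and> g \<otimes>\<^bsub>G\<^esub> h = k}"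
    and sup: "\<And>g h. \<lbrakk>g \<in> supp f; h \<in> supp_S s; g \<otimes>\<^bsub>G\<^esub> h = k\<rbrakk> \<Longrightarrow> (g, h) \<in> A"
  shows "(f \<star>\<^bsub>T\<^esub> s) k = finsum M (\<lambda>(g, h). f g \<star>\<^bsub>M\<^esub> (\<sigma> g (s h) \<otimes>\<^bsub>R\<^esub> c g h)) A"
proof -
  have "finsum M (\<lambda>(g, h). f g \<star>\<^bsub>M\<^esub> (\<sigma> g (s h) \<otimes>\<^bsub>R\<^esub> c g h))
      {(g, h). g \<in> carrier G \<and> h \<in> carrier G \<and> g \<otimes>\<^bsub>G\<^esub> h = k \<and> f g \<noteq> \<zero>\<^bsub>M\<^esub> \<and> s h \<noteq> \<zero>\<^bsub>R\<^esub>}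
    = finsum M (\<lambda>(g, h). f g \<star>\<^bsub>M\<^esub> (\<sigma> g (s h) \<otimes>\<^bsub>R\<^esub> c g h)) A"
    by (rule M.add.finprod_mono_neutral_cong_left[OF fin])
      (use A f s in \<open>auto intro!: sup simp: supp_def supp_S_def\<close>)
  then show ?thesis
    using k by (simp add: cp_module_def)
qed

lemma finite_pairs:
  assumes "finite A" "finite B"
  shows "finite {(g, h). g \<in> A \<and> h \<in> B \<and> g \<otimes>\<^bsub>G\<^esub> h = k}"
  by (rule finite_subset[of _ "A \<times> B"]) (use assms in auto)

text \<open>Here \<open>A\<close> and \<open>B\<close> may exceed the supports, so that several
  products can be compared over one index set.\<close>

lemma act_eq:
  assumes f: "f \<in> carrier T" and s: "s \<in> carrier S" and k: "k \<in> carrier G"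
    and fin: "finite A" "finite B" and sub: "A \<subseteq> carrier G" "B \<subseteq> carrier G"
    and sup: "supp f \<subseteq> A" "supp_S s \<subseteq> B"
  shows "(f \<star>\<^bsub>T\<^esub> s) k = finsum M (\<lambda>(g, h). f g \<star>\<^bsub>M\<^esub> (\<sigma> g (s h) \<otimes>\<^bsub>R\<^esub> c g h))
    {(g, h). g \<in> A \<and> h \<in> B \<and> g \<otimes>\<^bsub>G\<^esub> h = k}"
  by (rule act_eq_finsum[OF f s k finite_pairs[OF fin]]) (use sub sup in auto)

lemma supp_subset [simp]: "supp f \<subseteq> carrier G" "supp_S s \<subseteq> carrier G"
  by (auto simp: supp_def supp_S_def)

lemma act_coeff_closed:
  assumes "f \<in> carrier T" "s \<in> carrier S" "k \<in> carrier G"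
  shows "(f \<star>\<^bsub>T\<^esub> s) k \<in> carrier M"
  unfolding act_eq[OF assms T_finite[OF assms(1)] S_finite[OF assms(2)] supp_subset order_refl order_refl]
  using assms by (intro M.finsum_closed) (auto simp: supp_def supp_S_def)

lemma act_eq_zero:
  assumes "f \<in> carrier T" "s \<in> carrier S" "k \<in> carrier G"
    and "\<And>g h. \<lbrakk>g \<in> supp f; h \<in> supp_S s\<rbrakk> \<Longrightarrow> g \<otimes>\<^bsub>G\<^esub> h \<noteq> k"
  shows "(f \<star>\<^bsub>T\<^esub> s) k = \<zero>\<^bsub>M\<^esub>"
proof -
  have A: "{(g, h). g \<in> supp f \<and> h \<in> supp_S s \<and> g \<otimes>\<^bsub>G\<^esub> h = k} = {}"
    using assms(4) by auto
  show ?thesis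
    unfolding act_eq[OF assms(1-3) T_finite[OF assms(1)] S_finite[OF assms(2)] supp_subset order_refl order_refl] A
    by simp
qed

lemma act_closed [simp]:
  assumes "f \<in> carrier T" "s \<in> carrier S"
  shows "f \<star>\<^bsub>T\<^esub> s \<in> carrier T"
proof (rule T_memI)
  show "finite ((\<lambda>(g, h). g \<otimes>\<^bsub>G\<^esub> h) ` (supp f \<times> supp_S s))"
    using assms by simp
  show "k \<in> (\<lambda>(g, h). g \<otimes>\<^bsub>G\<^esub> h) ` (supp f \<times> supp_S s)"
    if "k \<in> carrier G" "(f \<star>\<^bsub>T\<^esub> s) k \<noteq> \<zero>\<^bsub>M\<^esub>" for k
    using act_eq_zero[OF assms that(1)] that(2) by force
qed (use assms act_coeff_closed in auto)

lemma supp_add: "supp (f \<oplus>\<^bsub>T\<^esub> f') \<subseteq> supp f \<union> supp f'"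
  and supp_S_add: "supp_S (s \<oplus>\<^bsub>S\<^esub> t) \<subseteq> supp_S s \<union> supp_S t"
  by (auto simp: supp_def supp_S_def)

lemma act_add_vector:
  assumes f: "f \<in> carrier T" "f' \<in> carrier T" and s: "s \<in> carrier S"
  shows "(f \<oplus>\<^bsub>T\<^esub> f') \<star>\<^bsub>T\<^esub> s = f \<star>\<^bsub>T\<^esub> s \<oplus>\<^bsub>T\<^esub> f' \<star>\<^bsub>T\<^esub> s"
proof (rule T_ext)
  fix k assume k: "k \<in> carrier G"
  interpret T: abelian_group T by (rule abelian_group_T)
  \<comment> \<open>The union serves all three products: by cancellation the support of the sum may
    be smaller than either of the two.\<close>
  let ?A = "supp f \<union> supp f'" and ?B = "supp_S s"
  have "finsum M (\<lambda>(g, h). (f \<oplus>\<^bsub>T\<^esub> f') g \<star>\<^bsub>M\<^esub> (\<sigma> g (s h) \<otimes>\<^bsub>R\<^esub> c g h))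
      {(g, h). g \<in> ?A \<and> h \<in> ?B \<and> g \<otimes>\<^bsub>G\<^esub> h = k}
    = finsum M (\<lambda>p. (case p of (g, h) \<Rightarrow> f g \<star>\<^bsub>M\<^esub> (\<sigma> g (s h) \<otimes>\<^bsub>R\<^esub> c g h))
        \<oplus>\<^bsub>M\<^esub> (case p of (g, h) \<Rightarrow> f' g \<star>\<^bsub>M\<^esub> (\<sigma> g (s h) \<otimes>\<^bsub>R\<^esub> c g h)))
      {(g, h). g \<in> ?A \<and> h \<in> ?B \<and> g \<otimes>\<^bsub>G\<^esub> h = k}"
    using f s by (intro M.finsum_cong') (auto simp: supp_def supp_S_def rsmult_add_vector)
  also have "\<dots> = finsum M (\<lambda>(g, h). f g \<star>\<^bsub>M\<^esub> (\<sigma> g (s h) \<otimes>\<^bsub>R\<^esub> c g h))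
      {(g, h). g \<in> ?A \<and> h \<in> ?B \<and> g \<otimes>\<^bsub>G\<^esub> h = k}
    \<oplus>\<^bsub>M\<^esub> finsum M (\<lambda>(g, h). f' g \<star>\<^bsub>M\<^esub> (\<sigma> g (s h) \<otimes>\<^bsub>R\<^esub> c g h))
      {(g, h). g \<in> ?A \<and> h \<in> ?B \<and> g \<otimes>\<^bsub>G\<^esub> h = k}"
    using f s by (intro M.finsum_addf) (auto simp: supp_def supp_S_def)
  finally show "((f \<oplus>\<^bsub>T\<^esub> f') \<star>\<^bsub>T\<^esub> s) k = (f \<star>\<^bsub>T\<^esub> s \<oplus>\<^bsub>T\<^esub> f' \<star>\<^bsub>T\<^esub> s) k"
    using f s k supp_add[of f f'] by (simp add: act_eq[where A = ?A and B = ?B])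
qed simp_all

lemma S_add_closed:
  assumes "s \<in> carrier S" "t \<in> carrier S" shows "s \<oplus>\<^bsub>S\<^esub> t \<in> carrier S"
proof -
  have "finite (supp_S (s \<oplus>\<^bsub>S\<^esub> t))"
    by (rule finite_subset[OF supp_S_add]) (use assms in simp)
  moreover have "s \<oplus>\<^bsub>S\<^esub> t \<in> carrier G \<rightarrow>\<^sub>E carrier R"
    using assms by (auto simp: PiE_def)
  ultimately show ?thesis
    unfolding S_mem_iff by simp
qed

lemma act_add_scalar:
  assumes f: "f \<in> carrier T" and s: "s \<in> carrier S" "t \<in> carrier S"
  shows "f \<star>\<^bsub>T\<^esub> (s \<oplus>\<^bsub>S\<^esub> t) = f \<star>\<^bsub>T\<^esub> s \<oplus>\<^bsub>T\<^esub> f \<star>\<^bsub>T\<^esub> t"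
proof (rule T_ext)
  fix k assume k: "k \<in> carrier G"
  let ?A = "supp f" and ?B = "supp_S s \<union> supp_S t"
  have "finsum M (\<lambda>(g, h). f g \<star>\<^bsub>M\<^esub> (\<sigma> g ((s \<oplus>\<^bsub>S\<^esub> t) h) \<otimes>\<^bsub>R\<^esub> c g h))
      {(g, h). g \<in> ?A \<and> h \<in> ?B \<and> g \<otimes>\<^bsub>G\<^esub> h = k}
    = finsum M (\<lambda>p. (case p of (g, h) \<Rightarrow> f g \<star>\<^bsub>M\<^esub> (\<sigma> g (s h) \<otimes>\<^bsub>R\<^esub> c g h))
        \<oplus>\<^bsub>M\<^esub> (case p of (g, h) \<Rightarrow> f g \<star>\<^bsub>M\<^esub> (\<sigma> g (t h) \<otimes>\<^bsub>R\<^esub> c g h)))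
      {(g, h). g \<in> ?A \<and> h \<in> ?B \<and> g \<otimes>\<^bsub>G\<^esub> h = k}"
    using f s by (intro M.finsum_cong')
      (auto simp: supp_def supp_S_def sigma_add R.l_distr rsmult_add_scalar)
  also have "\<dots> = finsum M (\<lambda>(g, h). f g \<star>\<^bsub>M\<^esub> (\<sigma> g (s h) \<otimes>\<^bsub>R\<^esub> c g h))
      {(g, h). g \<in> ?A \<and> h \<in> ?B \<and> g \<otimes>\<^bsub>G\<^esub> h = k}
    \<oplus>\<^bsub>M\<^esub> finsum M (\<lambda>(g, h). f g \<star>\<^bsub>M\<^esub> (\<sigma> g (t h) \<otimes>\<^bsub>R\<^esub> c g h))
      {(g, h). g \<in> ?A \<and> h \<in> ?B \<and> g \<otimes>\<^bsub>G\<^esub> h = k}"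
    using f s by (intro M.finsum_addf) (auto simp: supp_def supp_S_def)
  finally show "(f \<star>\<^bsub>T\<^esub> (s \<oplus>\<^bsub>S\<^esub> t)) k = (f \<star>\<^bsub>T\<^esub> s \<oplus>\<^bsub>T\<^esub> f \<star>\<^bsub>T\<^esub> t) k"
    using f s k supp_S_add[of s t] by (simp add: act_eq[where A = ?A and B = ?B] S_add_closed)
qed simp_all

text \<open>The action on generators. Together with additivity in both arguments it determines the
  whole module structure.\<close>

lemma single_act_single:
  assumes "m \<in> carrier M" "r \<in> carrier R" "g \<in> carrier G" "h \<in> carrier G"
  shows "cp_single M G m g \<star>\<^bsub>T\<^esub> cp_single R G r h
    = cp_single M G (m \<star>\<^bsub>M\<^esub> (\<sigma> g r \<otimes>\<^bsub>R\<^esub> c g h)) (g \<otimes>\<^bsub>G\<^esub> h)"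
proof (rule T_ext)
  fix k assume k: "k \<in> carrier G"
  have A: "{(g', h'). g' \<in> {g} \<and> h' \<in> {h} \<and> g' \<otimes>\<^bsub>G\<^esub> h' = k} = (if g \<otimes>\<^bsub>G\<^esub> h = k then {(g, h)} else {})"
    by auto
  have "(cp_single M G m g \<star>\<^bsub>T\<^esub> cp_single R G r h) k
    = finsum M (\<lambda>(g', h'). cp_single M G m g g' \<star>\<^bsub>M\<^esub> (\<sigma> g' (cp_single R G r h h') \<otimes>\<^bsub>R\<^esub> c g' h'))
        {(g', h'). g' \<in> {g} \<and> h' \<in> {h} \<and> g' \<otimes>\<^bsub>G\<^esub> h' = k}"
    by (rule act_eq) (use assms k in \<open>auto simp: supp_def supp_S_def split: if_splits\<close>)
  then show "(cp_single M G m g \<star>\<^bsub>T\<^esub> cp_single R G r h) k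
    = cp_single M G (m \<star>\<^bsub>M\<^esub> (\<sigma> g r \<otimes>\<^bsub>R\<^esub> c g h)) (g \<otimes>\<^bsub>G\<^esub> h) k"
    unfolding A using assms k by auto
qed simp_all

end

section \<open>The crossed product is a ring\<close>

lemma cp_single_regular_module [simp]: "cp_single (regular_module R) G r g = cp_single R G r g"
  by (simp only: cp_single_def regular_module_simps)

text \<open>The model over the regular module and the crossed product are records of different
  types. They can only be compared field by field, and this carries the group laws across.\<close>

lemma abelian_group_cong:
  assumes "abelian_group A" "carrier B = carrier A" "(\<oplus>\<^bsub>B\<^esub>) = (\<oplus>\<^bsub>A\<^esub>)" "\<zero>\<^bsub>B\<^esub> = \<zero>\<^bsub>A\<^esub>"
  shows "abelian_group B"
proof -
  interpret A: abelian_group A by fact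
  show ?thesis
    by (rule abelian_groupI) (auto simp: assms(2-4) A.a_ac intro: A.l_neg A.a_inv_closed)
qed

context crossed_system
begin

lemma crossed_module_regular: "crossed_module R G \<sigma> c (regular_module R)"
  by (intro crossed_module.intro crossed_system_axioms R.right_module_regular)

interpretation reg: crossed_module R G \<sigma> c "regular_module R"
  by (rule crossed_module_regular)

lemma carrier_cp_regular: "carrier (cp_module R G \<sigma> c (regular_module R)) = carrier (crossed_product R G \<sigma> c)"
  and add_cp_regular: "(\<oplus>\<^bsub>cp_module R G \<sigma> c (regular_module R)\<^esub>) = (\<oplus>\<^bsub>crossed_product R G \<sigma> c\<^esub>)"
  and zero_cp_regular: "\<zero>\<^bsub>cp_module R G \<sigma> c (regular_module R)\<^esub> = \<zero>\<^bsub>crossed_product R G \<sigma> c\<^esub>"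
  by (simp_all add: cp_module_def crossed_product_def)

lemma abelian_group_crossed_product: "abelian_group (crossed_product R G \<sigma> c)"
  by (rule abelian_group_cong[OF reg.abelian_group_T])
    (simp_all only: carrier_cp_regular add_cp_regular zero_cp_regular)

text \<open>The two definitions differ only in bracketing: the action multiplies the coefficient by
  an already formed product, the ring multiplication associates to the left.\<close>

lemma rsmult_cp_regular:
  assumes s: "s \<in> carrier (crossed_product R G \<sigma> c)" and t: "t \<in> carrier (crossed_product R G \<sigma> c)"
  shows "s \<star>\<^bsub>cp_module R G \<sigma> c (regular_module R)\<^esub> t = s \<otimes>\<^bsub>crossed_product R G \<sigma> c\<^esub> t"
proof -
  have *: "finsum R (\<lambda>(g, h). s g \<otimes>\<^bsub>R\<^esub> (\<sigma> g (t h) \<otimes>\<^bsub>R\<^esub> c g h)) A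
    = finsum R (\<lambda>(g, h). s g \<otimes>\<^bsub>R\<^esub> \<sigma> g (t h) \<otimes>\<^bsub>R\<^esub> c g h) A"
    if "A \<subseteq> carrier G \<times> carrier G" for A
    by (rule R.finsum_cong') (use that s t in \<open>auto simp: R.m_assoc\<close>)
  \<comment> \<open>The index set is kept in the form membership plus an arbitrary \<open>P\<close>,
    so that it matches the set occurring in both definitions.\<close>
  have "finsum R (\<lambda>(g, h). s g \<otimes>\<^bsub>R\<^esub> (\<sigma> g (t h) \<otimes>\<^bsub>R\<^esub> c g h)) {(g, h). g \<in> carrier G \<and> h \<in> carrier G \<and> P g h}
    = finsum R (\<lambda>(g, h). s g \<otimes>\<^bsub>R\<^esub> \<sigma> g (t h) \<otimes>\<^bsub>R\<^esub> c g h) {(g, h). g \<in> carrier G \<and> h \<in> carrier G \<and> P g h}" for P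
    by (rule *) auto
  then show ?thesis
    by (simp add: cp_module_def crossed_product_def)
qed

lemma crossed_product_induct [consumes 1, case_names single add]:
  assumes "s \<in> carrier (crossed_product R G \<sigma> c)"
    and "\<And>r g. \<lbrakk>r \<in> carrier R; g \<in> carrier G\<rbrakk> \<Longrightarrow> P (cp_single R G r g)"
    and "\<And>s t. \<lbrakk>s \<in> carrier (crossed_product R G \<sigma> c); t \<in> carrier (crossed_product R G \<sigma> c); P s; P t\<rbrakk>
      \<Longrightarrow> P (s \<oplus>\<^bsub>crossed_product R G \<sigma> c\<^esub> t)"
  shows "P s"
  using reg.T_induct[of s P] assms
  by (simp add: carrier_cp_regular add_cp_regular)

lemma crossed_product_mult_closed:
  "\<lbrakk>s \<in> carrier (crossed_product R G \<sigma> c); t \<in> carrier (crossed_product R G \<sigma> c)\<rbrakk>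
    \<Longrightarrow> s \<otimes>\<^bsub>crossed_product R G \<sigma> c\<^esub> t \<in> carrier (crossed_product R G \<sigma> c)"
  using reg.act_closed[of s t] by (simp add: carrier_cp_regular rsmult_cp_regular)

lemma crossed_product_l_distr:
  assumes "s \<in> carrier (crossed_product R G \<sigma> c)" "s' \<in> carrier (crossed_product R G \<sigma> c)"
    "t \<in> carrier (crossed_product R G \<sigma> c)"
  shows "(s \<oplus>\<^bsub>crossed_product R G \<sigma> c\<^esub> s') \<otimes>\<^bsub>crossed_product R G \<sigma> c\<^esub> t
    = s \<otimes>\<^bsub>crossed_product R G \<sigma> c\<^esub> t \<oplus>\<^bsub>crossed_product R G \<sigma> c\<^esub> s' \<otimes>\<^bsub>crossed_product R G \<sigma> c\<^esub> t"
  using reg.act_add_vector[of s s' t] assms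
  by (simp add: carrier_cp_regular add_cp_regular rsmult_cp_regular reg.S_add_closed)

lemma crossed_product_r_distr:
  assumes "s \<in> carrier (crossed_product R G \<sigma> c)" "t \<in> carrier (crossed_product R G \<sigma> c)"
    "t' \<in> carrier (crossed_product R G \<sigma> c)"
  shows "s \<otimes>\<^bsub>crossed_product R G \<sigma> c\<^esub> (t \<oplus>\<^bsub>crossed_product R G \<sigma> c\<^esub> t')
    = s \<otimes>\<^bsub>crossed_product R G \<sigma> c\<^esub> t \<oplus>\<^bsub>crossed_product R G \<sigma> c\<^esub> s \<otimes>\<^bsub>crossed_product R G \<sigma> c\<^esub> t'"
  using reg.act_add_scalar[of s t t'] assms
  by (simp add: carrier_cp_regular add_cp_regular rsmult_cp_regular reg.S_add_closed)

text \<open>The core of associativity. The twist law moves \<open>c g h\<close> to the right of the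
  doubly twisted \<open>r'\<close>, and the cocycle law then rewrites the product of the two values
  of \<open>c\<close>.\<close>

lemma coefficient_assoc:
  assumes g: "g \<in> carrier G" and h: "h \<in> carrier G" and i: "i \<in> carrier G"
    and r: "r \<in> carrier R" and r': "r' \<in> carrier R"
  shows "(\<sigma> g r \<otimes>\<^bsub>R\<^esub> c g h) \<otimes>\<^bsub>R\<^esub> (\<sigma> (g \<otimes>\<^bsub>G\<^esub> h) r' \<otimes>\<^bsub>R\<^esub> c (g \<otimes>\<^bsub>G\<^esub> h) i)
    = \<sigma> g (r \<otimes>\<^bsub>R\<^esub> \<sigma> h r' \<otimes>\<^bsub>R\<^esub> c h i) \<otimes>\<^bsub>R\<^esub> c g (h \<otimes>\<^bsub>G\<^esub> i)" (is "?l = ?r")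
proof -
  have "?l = \<sigma> g r \<otimes>\<^bsub>R\<^esub> ((c g h \<otimes>\<^bsub>R\<^esub> \<sigma> (g \<otimes>\<^bsub>G\<^esub> h) r') \<otimes>\<^bsub>R\<^esub> c (g \<otimes>\<^bsub>G\<^esub> h) i)"
    using assms by (simp add: R.m_assoc)
  also have "\<dots> = \<sigma> g r \<otimes>\<^bsub>R\<^esub> (\<sigma> g (\<sigma> h r') \<otimes>\<^bsub>R\<^esub> (c g h \<otimes>\<^bsub>R\<^esub> c (g \<otimes>\<^bsub>G\<^esub> h) i))"
    using assms by (simp add: R.m_assoc flip: sigma_twist)
  also have "\<dots> = \<sigma> g r \<otimes>\<^bsub>R\<^esub> (\<sigma> g (\<sigma> h r') \<otimes>\<^bsub>R\<^esub> (\<sigma> g (c h i) \<otimes>\<^bsub>R\<^esub> c g (h \<otimes>\<^bsub>G\<^esub> i)))"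
    using assms by (simp only: cocycle)
  also have "\<dots> = ?r"
    using assms by (simp add: R.m_assoc reg.sigma_mult)
  finally show ?thesis .
qed

end

context crossed_module
begin

interpretation S: abelian_group S by (rule abelian_group_crossed_product)
interpretation T: abelian_group T by (rule abelian_group_T)

text \<open>Both sides are additive in each of the three arguments, so generators suffice; there the
  claim is \<open>coefficient_assoc\<close> together with associativity in \<open>G\<close>.\<close>

lemma act_assoc:
  assumes f: "f \<in> carrier T" and s: "s \<in> carrier S" and t: "t \<in> carrier S"
  shows "f \<star>\<^bsub>T\<^esub> (s \<otimes>\<^bsub>S\<^esub> t) = (f \<star>\<^bsub>T\<^esub> s) \<star>\<^bsub>T\<^esub> t"
proof -
  note distrib = act_add_vector act_add_scalar crossed_product_l_distr crossed_product_r_distr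
  from f show ?thesis
  proof (induction rule: T_induct)
    case f: (single m g)
    from s show ?case
    proof (induction rule: crossed_product_induct)
      case s: (single r h)
      from t show ?case
      proof (induction rule: crossed_product_induct)
        case (single r' i)
        have "m \<star>\<^bsub>M\<^esub> (\<sigma> g (r \<otimes>\<^bsub>R\<^esub> \<sigma> h r' \<otimes>\<^bsub>R\<^esub> c h i) \<otimes>\<^bsub>R\<^esub> c g (h \<otimes>\<^bsub>G\<^esub> i))
          = (m \<star>\<^bsub>M\<^esub> (\<sigma> g r \<otimes>\<^bsub>R\<^esub> c g h)) \<star>\<^bsub>M\<^esub> (\<sigma> (g \<otimes>\<^bsub>G\<^esub> h) r' \<otimes>\<^bsub>R\<^esub> c (g \<otimes>\<^bsub>G\<^esub> h) i)"
          using f s single by (simp flip: coefficient_assoc rsmult_assoc)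
        then show ?case
          using f s single by (simp add: cp_single_mult single_act_single G.m_assoc)
      next
        case (add t t')
        then show ?case
          using f s by (simp add: distrib crossed_product_mult_closed)
      qed
    next
      case (add s s')
      then show ?case
        using f t by (simp add: distrib crossed_product_mult_closed)
    qed
  next
    case (add f f')
    then show ?case
      using s t by (simp add: distrib crossed_product_mult_closed)
  qed
qed

lemma S_one_closed: "\<one>\<^bsub>S\<^esub> \<in> carrier S"
  by (simp add: S_one)

lemma act_one:
  assumes f: "f \<in> carrier T"
  shows "f \<star>\<^bsub>T\<^esub> \<one>\<^bsub>S\<^esub> = f"
  using f
proof (induction rule: T_induct)
  case (single m g)
  then show ?case
    by (simp add: S_one single_act_single c_one_right)
next
  case (add f f')
  then show ?case
    by (simp add: act_add_vector S_one_closed)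
qed

end

context crossed_system
begin

interpretation reg: crossed_module R G \<sigma> c "regular_module R"
  by (rule crossed_module_regular)

text \<open>Associativity and the right unit law are the module laws of the model, read off for the
  regular module.\<close>

lemma ring_crossed_product: "ring (crossed_product R G \<sigma> c)"
proof (rule ringI)
  let ?S = "crossed_product R G \<sigma> c"
  show "monoid ?S"
  proof (rule monoidI)
    show "\<one>\<^bsub>?S\<^esub> \<in> carrier ?S" by (rule reg.S_one_closed)
    show "s \<otimes>\<^bsub>?S\<^esub> t \<in> carrier ?S" if "s \<in> carrier ?S" "t \<in> carrier ?S" for s t
      using that by (rule crossed_product_mult_closed)
    show "s \<otimes>\<^bsub>?S\<^esub> t \<otimes>\<^bsub>?S\<^esub> u = s \<otimes>\<^bsub>?S\<^esub> (t \<otimes>\<^bsub>?S\<^esub> u)"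
      if "s \<in> carrier ?S" "t \<in> carrier ?S" "u \<in> carrier ?S" for s t u
      using reg.act_assoc[of s t u] that
      by (simp add: carrier_cp_regular rsmult_cp_regular crossed_product_mult_closed)
    show "s \<otimes>\<^bsub>?S\<^esub> \<one>\<^bsub>?S\<^esub> = s" if "s \<in> carrier ?S" for s
      using reg.act_one[of s] that
      by (simp add: carrier_cp_regular rsmult_cp_regular reg.S_one_closed)
    show "\<one>\<^bsub>?S\<^esub> \<otimes>\<^bsub>?S\<^esub> s = s" if "s \<in> carrier ?S" for s
      using that
    \<comment> \<open>The left unit law is not a module law, so it is checked on generators, where
      it rests on the normalization of \<open>\<sigma>\<close> and \<open>c\<close> at the
      identity.\<close>
    proof (induction rule: crossed_product_induct)
      case (single r g)
      then show ?case
        by (simp add: reg.S_one cp_single_mult sigma_one c_one_left)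
    next
      case (add s t)
      then show ?case
        by (simp add: crossed_product_r_distr reg.S_one_closed)
    qed
  qed
qed (use abelian_group_crossed_product crossed_product_l_distr crossed_product_r_distr in auto)

end

context crossed_module
begin

lemma right_module_T: "right_module S T"
  by (intro right_module.intro right_module_axioms.intro ring_crossed_product abelian_group_T
      act_closed act_add_scalar act_add_vector act_assoc act_one)

end

section \<open>The induced module\<close>

text \<open>Pulling a submodule of \<open>T\<close> back along \<open>\<theta>\<close> leaves its
  annihilator unchanged, since \<open>\<theta>\<close> respects the action and sends only zero to
  zero.\<close>

lemma prime_module_iso_imp:
  fixes S :: "('s, 'q) ring_scheme" and E :: "('s, 'e, 'k) module_scheme"
    and T :: "('s, 't, 'l) module_scheme"
  assumes E: "right_module S E" and T: "right_module S T"
    and bij: "bij_betw \<theta> (carrier E) (carrier T)"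
    and add: "\<And>x y. \<lbrakk>x \<in> carrier E; y \<in> carrier E\<rbrakk> \<Longrightarrow> \<theta> (x \<oplus>\<^bsub>E\<^esub> y) = \<theta> x \<oplus>\<^bsub>T\<^esub> \<theta> y"
    and smult: "\<And>x s. \<lbrakk>x \<in> carrier E; s \<in> carrier S\<rbrakk> \<Longrightarrow> \<theta> (x \<star>\<^bsub>E\<^esub> s) = \<theta> x \<star>\<^bsub>T\<^esub> s"
    and prime: "prime_module S E"
  shows "prime_module S T"
proof -
  interpret E: right_module S E by fact
  interpret T: right_module S T by fact
  interpret P: prime_module S E by fact
  have closed: "\<theta> x \<in> carrier T" if "x \<in> carrier E" for x
    using bij that by (auto simp: bij_betw_def)
  have inj: "x = y" if "\<theta> x = \<theta> y" "x \<in> carrier E" "y \<in> carrier E" for x y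
    using bij that by (auto simp: bij_betw_def inj_on_def)
  have zero: "\<theta> \<zero>\<^bsub>E\<^esub> = \<zero>\<^bsub>T\<^esub>"
    using add[of "\<zero>\<^bsub>E\<^esub>" "\<zero>\<^bsub>E\<^esub>"] closed[of "\<zero>\<^bsub>E\<^esub>"] by simp
  have zero_iff: "\<theta> x = \<zero>\<^bsub>T\<^esub> \<longleftrightarrow> x = \<zero>\<^bsub>E\<^esub>" if "x \<in> carrier E" for x
    using inj[of x "\<zero>\<^bsub>E\<^esub>"] zero that by auto
  have minus: "\<theta> (\<ominus>\<^bsub>E\<^esub> x) = \<ominus>\<^bsub>T\<^esub> \<theta> x" if "x \<in> carrier E" for x
    using add[of "\<ominus>\<^bsub>E\<^esub> x" x] closed that zero
    by (metis E.M.a_inv_closed E.M.l_neg T.M.minus_equality)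
  have ex: "\<exists>x\<in>carrier E. y = \<theta> x" if "y \<in> carrier T" for y
    using bij that by (auto simp: bij_betw_def)
  have ann: "ann S E {x \<in> carrier E. \<theta> x \<in> N} = ann S T N" if N: "N \<subseteq> carrier T" for N
  proof -
    have "x \<star>\<^bsub>E\<^esub> s = \<zero>\<^bsub>E\<^esub> \<longleftrightarrow> \<theta> x \<star>\<^bsub>T\<^esub> s = \<zero>\<^bsub>T\<^esub>" if "x \<in> carrier E" "s \<in> carrier S" for x s
      using that by (simp add: zero_iff flip: smult)
    moreover have "(\<forall>y\<in>N. y \<star>\<^bsub>T\<^esub> s = \<zero>\<^bsub>T\<^esub>) \<longleftrightarrow> (\<forall>x\<in>carrier E. \<theta> x \<in> N \<longrightarrow> \<theta> x \<star>\<^bsub>T\<^esub> s = \<zero>\<^bsub>T\<^esub>)" for s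
      using N ex by (metis subsetD)
    ultimately show ?thesis
      unfolding ann_def by auto
  qed
  show ?thesis
  proof (intro prime_module.intro prime_module_axioms.intro T)
    show "carrier T \<noteq> {\<zero>\<^bsub>T\<^esub>}"
      using P.nonzero closed zero_iff by blast
  next
    fix N assume N: "submodule N S T" "N \<noteq> {\<zero>\<^bsub>T\<^esub>}"
    interpret N: submodule N S T by fact
    have sub: "submodule {x \<in> carrier E. \<theta> x \<in> N} S E"
    proof (intro submodule.intro submodule_axioms.intro E.M.add.subgroupI)
      show "{x \<in> carrier E. \<theta> x \<in> N} \<noteq> {}"
        using zero N.one_closed by auto
    qed (use N.m_closed N.m_inv_closed in \<open>auto simp: add minus smult simp flip: a_inv_def\<close>)
    obtain y where "y \<in> N" "y \<noteq> \<zero>\<^bsub>T\<^esub>"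
      using N(2) N.one_closed by auto
    moreover obtain x where "x \<in> carrier E" "y = \<theta> x"
      using ex[of y] \<open>y \<in> N\<close> N.subset by auto
    ultimately have "x \<in> {x \<in> carrier E. \<theta> x \<in> N}" "x \<noteq> \<zero>\<^bsub>E\<^esub>"
      using zero by auto
    then have "{x \<in> carrier E. \<theta> x \<in> N} \<noteq> {\<zero>\<^bsub>E\<^esub>}"
      by blast
    from P.ann_eq[OF sub this]
    have "ann S T N = ann S E (carrier E)"
      using ann[of N] N.subset by simp
    also have "\<dots> = ann S T (carrier T)"
    proof -
      have "{x \<in> carrier E. \<theta> x \<in> carrier T} = carrier E"
        using closed by auto
      then show ?thesis
        using ann[of "carrier T"] by simp
    qed
    finally show "ann S T N = ann S T (carrier T)" .
  qed
qed

text \<open>\<open>E\<close> is only required to be closed under its operations: the module laws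
  hold in it because they hold in \<open>T\<close> and \<open>\<theta>\<close> is injective. This
  spares checking them on cosets.\<close>

lemma prime_module_iso_iff:
  fixes S :: "('s, 'q) ring_scheme" and E :: "('s, 'e, 'k) module_scheme"
    and T :: "('s, 't, 'l) module_scheme"
  assumes T: "right_module S T"
    and bij: "bij_betw \<theta> (carrier E) (carrier T)"
    and add_closed: "\<And>x y. \<lbrakk>x \<in> carrier E; y \<in> carrier E\<rbrakk> \<Longrightarrow> x \<oplus>\<^bsub>E\<^esub> y \<in> carrier E"
    and zero_closed: "\<zero>\<^bsub>E\<^esub> \<in> carrier E"
    and smult_closed: "\<And>x s. \<lbrakk>x \<in> carrier E; s \<in> carrier S\<rbrakk> \<Longrightarrow> x \<star>\<^bsub>E\<^esub> s \<in> carrier E"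
    and add: "\<And>x y. \<lbrakk>x \<in> carrier E; y \<in> carrier E\<rbrakk> \<Longrightarrow> \<theta> (x \<oplus>\<^bsub>E\<^esub> y) = \<theta> x \<oplus>\<^bsub>T\<^esub> \<theta> y"
    and zero: "\<theta> \<zero>\<^bsub>E\<^esub> = \<zero>\<^bsub>T\<^esub>"
    and smult: "\<And>x s. \<lbrakk>x \<in> carrier E; s \<in> carrier S\<rbrakk> \<Longrightarrow> \<theta> (x \<star>\<^bsub>E\<^esub> s) = \<theta> x \<star>\<^bsub>T\<^esub> s"
  shows "prime_module S E \<longleftrightarrow> prime_module S T"
proof -
  interpret T: right_module S T by fact
  have closed [simp]: "\<theta> x \<in> carrier T" if "x \<in> carrier E" for x
    using bij that by (auto simp: bij_betw_def)
  have inj: "x = y" if "\<theta> x = \<theta> y" "x \<in> carrier E" "y \<in> carrier E" for x y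
    using bij that by (auto simp: bij_betw_def inj_on_def)
  note [simp] = add zero smult add_closed zero_closed smult_closed
  have "abelian_group E"
  proof (rule abelian_groupI)
    show "\<exists>y\<in>carrier E. y \<oplus>\<^bsub>E\<^esub> x = \<zero>\<^bsub>E\<^esub>" if x: "x \<in> carrier E" for x
    proof -
      obtain y where "y \<in> carrier E" "\<theta> y = \<ominus>\<^bsub>T\<^esub> \<theta> x"
        using bij x by (metis T.M.a_inv_closed bij_betw_imp_surj_on closed imageE)
      then show ?thesis
        using x by (intro bexI[of _ y] inj) (auto simp: T.M.l_neg)
    qed
  qed (auto intro!: inj simp: T.M.a_ac)
  then have E: "right_module S E"
    using T.R.ring_axioms
    by (intro right_module.intro right_module_axioms.intro)
      (auto intro!: inj simp: T.rsmult_add_scalar T.rsmult_add_vector T.rsmult_assoc)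
  let ?\<psi> = "inv_into (carrier E) \<theta>"
  have \<psi>: "?\<psi> y \<in> carrier E" "\<theta> (?\<psi> y) = y" if "y \<in> carrier T" for y
    using bij that by (auto simp: bij_betw_def intro: inv_into_into f_inv_into_f)
  show "prime_module S E \<longleftrightarrow> prime_module S T"
  proof
    assume "prime_module S E"
    then show "prime_module S T"
      using prime_module_iso_imp[OF E T bij] by simp
  next
    assume "prime_module S T"
    then show "prime_module S E"
    proof (rule prime_module_iso_imp[OF T E bij_betw_inv_into[OF bij], rotated -1])
      show "?\<psi> (x \<oplus>\<^bsub>T\<^esub> y) = ?\<psi> x \<oplus>\<^bsub>E\<^esub> ?\<psi> y" if "x \<in> carrier T" "y \<in> carrier T" for x y
        using that by (intro inj) (simp_all add: \<psi>)
      show "?\<psi> (x \<star>\<^bsub>T\<^esub> s) = ?\<psi> x \<star>\<^bsub>E\<^esub> s" if "x \<in> carrier T" "s \<in> carrier S" for x s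
        using that by (intro inj) (simp_all add: \<psi>)
    qed
  qed
qed

context crossed_module
begin

interpretation S: ring S by (rule ring_crossed_product)
interpretation T: right_module S T by (rule right_module_T)

section \<open>The free abelian group and the subgroup of tensor relations\<close>

abbreviation "F \<equiv> free_Abelian_group (carrier M \<times> carrier S)"
abbreviation "H \<equiv> generate F (tensor_relations R S (\<lambda>r. cp_single R G r \<one>\<^bsub>G\<^esub>) M)"
abbreviation "basis g \<equiv> cp_single R G \<one>\<^bsub>R\<^esub> g"

lemma tensor_relations_subset:
  "tensor_relations R S (\<lambda>r. cp_single R G r \<one>\<^bsub>G\<^esub>) M \<subseteq> carrier F"
  by (auto simp: tensor_relations_def keys_frag_of dest!: subsetD[OF keys_diff])

lemma subgroup_H: "subgroup H F"
  using group.generate_is_subgroup[OF group_free_Abelian_group tensor_relations_subset] .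

lemma H_keys: "u \<in> H \<Longrightarrow> Poly_Mapping.keys u \<subseteq> carrier M \<times> carrier S"
  using subgroup.mem_carrier[OF subgroup_H] by simp

lemma H_zero [simp]: "0 \<in> H"
  using subgroup.one_closed[OF subgroup_H] by simp

lemma H_add: "\<lbrakk>u \<in> H; v \<in> H\<rbrakk> \<Longrightarrow> u + v \<in> H"
  using subgroup.m_closed[OF subgroup_H, of u v] by simp

lemma H_minus: "u \<in> H \<Longrightarrow> - u \<in> H"
  using subgroup.m_inv_closed[OF subgroup_H, of u] H_keys[of u] by simp

lemma H_diff: "\<lbrakk>u \<in> H; v \<in> H\<rbrakk> \<Longrightarrow> u - v \<in> H"
  using H_add[of u "- v"] H_minus[of v] by simp

lemma H_sum: "(\<And>i. i \<in> I \<Longrightarrow> u i \<in> H) \<Longrightarrow> sum u I \<in> H"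
  by (induction I rule: infinite_finite_induct) (auto simp: H_add)

lemma H_add_vector: "\<lbrakk>x \<in> carrier M; y \<in> carrier M; s \<in> carrier S\<rbrakk> \<Longrightarrow>
    frag_of (x \<oplus>\<^bsub>M\<^esub> y, s) - frag_of (x, s) - frag_of (y, s) \<in> H"
  and H_add_scalar: "\<lbrakk>x \<in> carrier M; s \<in> carrier S; t \<in> carrier S\<rbrakk> \<Longrightarrow>
    frag_of (x, s \<oplus>\<^bsub>S\<^esub> t) - frag_of (x, s) - frag_of (x, t) \<in> H"
  and H_balanced: "\<lbrakk>x \<in> carrier M; r \<in> carrier R; s \<in> carrier S\<rbrakk> \<Longrightarrow>
    frag_of (x \<star>\<^bsub>M\<^esub> r, s) - frag_of (x, cp_single R G r \<one>\<^bsub>G\<^esub> \<otimes>\<^bsub>S\<^esub> s) \<in> H"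
  by (rule generate.incl, auto simp: tensor_relations_def)+

text \<open>The additivity relation for zero plus zero is the negative of this generator.\<close>

lemma H_zero_vector: "s \<in> carrier S \<Longrightarrow> frag_of (\<zero>\<^bsub>M\<^esub>, s) \<in> H"
  using H_minus[OF H_add_vector[of "\<zero>\<^bsub>M\<^esub>" "\<zero>\<^bsub>M\<^esub>" s]] by simp

text \<open>A representative in the free abelian group of the tensor that \<open>f\<close> stands for.\<close>

definition rep :: "('g \<Rightarrow> 'm) \<Rightarrow> ('m \<times> ('g \<Rightarrow> 'r)) \<Rightarrow>\<^sub>0 int"
  where "rep f = (\<Sum>g\<in>supp f. frag_of (f g, basis g))"

text \<open>A point outside the support contributes only a tensor with zero first factor, which lies
  in \<open>H\<close>. Modulo \<open>H\<close> any finite index set containing the support may be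
  used.\<close>

lemma rep_eq:
  assumes "finite A" "A \<subseteq> carrier G" "supp f \<subseteq> A"
  shows "(\<Sum>g\<in>A. frag_of (f g, basis g)) - rep f \<in> H"
proof -
  have "(\<Sum>g\<in>A. frag_of (f g, basis g)) = (\<Sum>g\<in>A - supp f. frag_of (f g, basis g)) + rep f"
    unfolding rep_def using assms by (intro sum.subset_diff) auto
  moreover have "(\<Sum>g\<in>A - supp f. frag_of (f g, basis g)) \<in> H"
    by (rule H_sum) (use assms in \<open>auto simp: supp_def subset_iff intro!: H_zero_vector\<close>)
  ultimately show ?thesis by simp
qed

text \<open>Over the union of the supports the additivity relations apply term by term;
  \<open>rep_eq\<close> then corrects the three index sets.\<close>

lemma rep_add:
  assumes f: "f \<in> carrier T" "f' \<in> carrier T"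
  shows "rep (f \<oplus>\<^bsub>T\<^esub> f') - rep f - rep f' \<in> H"
proof -
  let ?A = "supp f \<union> supp f'"
  let ?s = "\<lambda>f. \<Sum>g\<in>?A. frag_of (f g, basis g)"
  have "?s (f \<oplus>\<^bsub>T\<^esub> f') = (\<Sum>g\<in>?A. frag_of (f g \<oplus>\<^bsub>M\<^esub> f' g, basis g))"
    by (rule sum.cong) (auto simp: supp_def)
  then have "?s (f \<oplus>\<^bsub>T\<^esub> f') - ?s f - ?s f'
      = (\<Sum>g\<in>?A. frag_of (f g \<oplus>\<^bsub>M\<^esub> f' g, basis g) - frag_of (f g, basis g) - frag_of (f' g, basis g))"
    by (simp only: sum_subtractf)
  also have "\<dots> \<in> H"
    by (rule H_sum, rule H_add_vector) (use f in \<open>auto simp: supp_def\<close>)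
  finally have 0: "?s (f \<oplus>\<^bsub>T\<^esub> f') - ?s f - ?s f' \<in> H" .
  have 1: "?s f - rep f \<in> H" "?s f' - rep f' \<in> H" "?s (f \<oplus>\<^bsub>T\<^esub> f') - rep (f \<oplus>\<^bsub>T\<^esub> f') \<in> H"
    by (rule rep_eq; use f supp_add[of f f'] in simp)+
  have "rep (f \<oplus>\<^bsub>T\<^esub> f') - rep f - rep f' = (?s (f \<oplus>\<^bsub>T\<^esub> f') - ?s f - ?s f')
      + (?s f - rep f) + (?s f' - rep f') - (?s (f \<oplus>\<^bsub>T\<^esub> f') - rep (f \<oplus>\<^bsub>T\<^esub> f'))"
    by simp
  then show ?thesis
    using 0 1 H_add H_diff by presburger
qed

text \<open>Only a congruence: for \<open>m\<close> zero the support is empty and \<open>rep\<close>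
  gives 0, not the generator.\<close>

lemma rep_single:
  assumes "m \<in> carrier M" "g \<in> carrier G"
  shows "frag_of (m, basis g) - rep (cp_single M G m g) \<in> H"
proof -
  have "supp (cp_single M G m g) \<subseteq> {g}"
    by (auto simp: supp_def split: if_splits)
  from rep_eq[OF _ _ this] show ?thesis
    using assms by simp
qed

lemma single_act:
  assumes "m \<in> carrier M" "r \<in> carrier R" "h \<in> carrier G"
  shows "cp_single M G m \<one>\<^bsub>G\<^esub> \<star>\<^bsub>T\<^esub> cp_single R G r h = cp_single M G (m \<star>\<^bsub>M\<^esub> r) h"
  using assms by (simp add: single_act_single sigma_one c_one_left)

text \<open>For a single term \<open>r g\<close> the balancing relation moves \<open>r\<close>
  across the tensor sign, leaving a multiple of a basis element; additivity gives the rest.\<close>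

lemma rep_tensor:
  assumes m: "m \<in> carrier M" and s: "s \<in> carrier S"
  shows "frag_of (m, s) - rep (cp_single M G m \<one>\<^bsub>G\<^esub> \<star>\<^bsub>T\<^esub> s) \<in> H"
  using s
proof (induction rule: crossed_product_induct)
  case (single r g)
  have "cp_single R G r \<one>\<^bsub>G\<^esub> \<otimes>\<^bsub>S\<^esub> basis g = cp_single R G r g"
    using single by (simp add: cp_single_mult c_one_left)
  then have 1: "frag_of (m \<star>\<^bsub>M\<^esub> r, basis g) - frag_of (m, cp_single R G r g) \<in> H"
    using H_balanced[of m r "basis g"] m single by simp
  have 2: "frag_of (m \<star>\<^bsub>M\<^esub> r, basis g) - rep (cp_single M G (m \<star>\<^bsub>M\<^esub> r) g) \<in> H"
    using m single by (simp add: rep_single)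
  show ?case
    using H_diff[OF 2 1] m single by (simp add: single_act)
next
  case (add s t)
  let ?m = "cp_single M G m \<one>\<^bsub>G\<^esub>"
  have 1: "frag_of (m, s \<oplus>\<^bsub>S\<^esub> t) - frag_of (m, s) - frag_of (m, t) \<in> H"
    using H_add_scalar m add by blast
  have 2: "rep (?m \<star>\<^bsub>T\<^esub> s \<oplus>\<^bsub>T\<^esub> ?m \<star>\<^bsub>T\<^esub> t) - rep (?m \<star>\<^bsub>T\<^esub> s) - rep (?m \<star>\<^bsub>T\<^esub> t) \<in> H"
    using m add by (simp add: rep_add)
  have "frag_of (m, s \<oplus>\<^bsub>S\<^esub> t) - rep (?m \<star>\<^bsub>T\<^esub> s \<oplus>\<^bsub>T\<^esub> ?m \<star>\<^bsub>T\<^esub> t)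
    = (frag_of (m, s \<oplus>\<^bsub>S\<^esub> t) - frag_of (m, s) - frag_of (m, t))
      + (frag_of (m, s) - rep (?m \<star>\<^bsub>T\<^esub> s)) + (frag_of (m, t) - rep (?m \<star>\<^bsub>T\<^esub> t))
      - (rep (?m \<star>\<^bsub>T\<^esub> s \<oplus>\<^bsub>T\<^esub> ?m \<star>\<^bsub>T\<^esub> t) - rep (?m \<star>\<^bsub>T\<^esub> s) - rep (?m \<star>\<^bsub>T\<^esub> t))"
    by simp
  also have "\<dots> \<in> H"
    using 1 2 add(3,4) H_add H_diff by presburger
  finally show ?case
    using m add by (simp add: act_add_scalar)
qed

section \<open>The homomorphism from the free abelian group to the model and its kernel\<close>

lemma tensor_hom_exists:
  "\<exists>\<Phi>. \<Phi> \<in> hom F (add_monoid T) \<and>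
    (\<forall>m\<in>carrier M. \<forall>s\<in>carrier S. \<Phi> (frag_of (m, s)) = cp_single M G m \<one>\<^bsub>G\<^esub> \<star>\<^bsub>T\<^esub> s)"
proof -
  have "(\<lambda>(m, s). cp_single M G m \<one>\<^bsub>G\<^esub> \<star>\<^bsub>T\<^esub> s) ` (carrier M \<times> carrier S) \<subseteq> carrier (add_monoid T)"
    by auto
  from comm_group.free_Abelian_group_universal[OF T.M.a_comm_group this] show ?thesis
    by (metis (mono_tags, lifting) SigmaI case_prod_conv)
qed

text \<open>The extension of the biadditive map that takes the pair \<open>(m, s)\<close> to m
  tensor 1 acted on by \<open>s\<close>. Only its values on \<open>F\<close> are determined, whence
  the conditions \<open>in_F\<close> below.\<close>

definition tensor_map :: "('m \<times> ('g \<Rightarrow> 'r) \<Rightarrow>\<^sub>0 int) \<Rightarrow> 'g \<Rightarrow> 'm"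
  where "tensor_map = (SOME \<Phi>. \<Phi> \<in> hom F (add_monoid T) \<and>
    (\<forall>m\<in>carrier M. \<forall>s\<in>carrier S. \<Phi> (frag_of (m, s)) = cp_single M G m \<one>\<^bsub>G\<^esub> \<star>\<^bsub>T\<^esub> s))"

lemma tensor_map_hom: "tensor_map \<in> hom F (add_monoid T)"
  and tensor_map_frag_of: "\<lbrakk>m \<in> carrier M; s \<in> carrier S\<rbrakk> \<Longrightarrow>
    tensor_map (frag_of (m, s)) = cp_single M G m \<one>\<^bsub>G\<^esub> \<star>\<^bsub>T\<^esub> s"
  using someI_ex[OF tensor_hom_exists] by (auto simp: tensor_map_def)

abbreviation "in_F u \<equiv> Poly_Mapping.keys u \<subseteq> carrier M \<times> carrier S"

lemma in_F_add: "\<lbrakk>in_F u; in_F v\<rbrakk> \<Longrightarrow> in_F (u + v)"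
  and in_F_diff: "\<lbrakk>in_F u; in_F v\<rbrakk> \<Longrightarrow> in_F (u - v)"
  using keys_add[of u v] keys_diff[of u v] by blast+

lemma tensor_map_closed [simp]: "in_F u \<Longrightarrow> tensor_map u \<in> carrier T"
  and tensor_map_add: "\<lbrakk>in_F u; in_F v\<rbrakk> \<Longrightarrow> tensor_map (u + v) = tensor_map u \<oplus>\<^bsub>T\<^esub> tensor_map v"
  using tensor_map_hom by (auto simp: hom_def)

lemma tensor_map_zero: "tensor_map 0 = \<zero>\<^bsub>T\<^esub>"
  using tensor_map_add[of 0 0] tensor_map_closed[of 0] by simp

lemma tensor_map_diff_add:
  assumes "in_F u" "in_F v" shows "tensor_map (u - v) \<oplus>\<^bsub>T\<^esub> tensor_map v = tensor_map u"
  using tensor_map_add[of "u - v" v] assms by (simp add: in_F_diff)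

lemma tensor_map_diff:
  assumes "in_F u" "in_F v" shows "tensor_map (u - v) = tensor_map u \<ominus>\<^bsub>T\<^esub> tensor_map v"
  using tensor_map_diff_add[OF assms] assms
  by (metis T.M.add.inv_solve_right T.M.minus_eq in_F_diff tensor_map_closed)

text \<open>The kernel is a subgroup, so it is enough that it contains the defining relations.
  Additivity of the action settles the first two kinds, associativity the balancing
  relations.\<close>

lemma tensor_map_H:
  assumes "u \<in> H" shows "tensor_map u = \<zero>\<^bsub>T\<^esub>"
proof -
  interpret \<Phi>: group_hom F "add_monoid T" tensor_map
    using tensor_map_hom T.M.add.is_group by (simp add: group_hom_def group_hom_axioms_def)
  have "tensor_relations R S (\<lambda>r. cp_single R G r \<one>\<^bsub>G\<^esub>) M \<subseteq> kernel F (add_monoid T) tensor_map"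
  proof
    fix u assume u: "u \<in> tensor_relations R S (\<lambda>r. cp_single R G r \<one>\<^bsub>G\<^esub>) M"
    then have "u \<in> carrier F"
      by (rule subsetD[OF tensor_relations_subset])
    then have F: "in_F u"
      by simp
    have single_add: "cp_single M G (x \<oplus>\<^bsub>M\<^esub> y) \<one>\<^bsub>G\<^esub> = cp_single M G x \<one>\<^bsub>G\<^esub> \<oplus>\<^bsub>T\<^esub> cp_single M G y \<one>\<^bsub>G\<^esub>"
      if "x \<in> carrier M" "y \<in> carrier M" for x y
      by (rule T_ext) (use that in auto)
    have "x \<oplus>\<^bsub>T\<^esub> y \<ominus>\<^bsub>T\<^esub> x \<ominus>\<^bsub>T\<^esub> y = \<zero>\<^bsub>T\<^esub>" if "x \<in> carrier T" "y \<in> carrier T" for x y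
      using that T.M.r_neg[of "x \<oplus>\<^bsub>T\<^esub> y"] by (simp add: T.M.minus_eq T.M.a_assoc T.M.minus_add)
    then have "tensor_map u = \<zero>\<^bsub>T\<^esub>"
      using u unfolding tensor_relations_def
      by (auto simp: tensor_map_diff in_F_diff keys_frag_of tensor_map_frag_of single_add
          act_add_vector act_add_scalar act_assoc single_act crossed_product_mult_closed
          T.M.minus_eq T.M.r_neg)
    then show "u \<in> kernel F (add_monoid T) tensor_map"
      using F by (simp add: kernel_def)
  qed
  from group.generate_subgroup_incl[OF group_free_Abelian_group this \<Phi>.subgroup_kernel]
  show ?thesis
    using assms by (auto simp: kernel_def)
qed

text \<open>Modulo \<open>H\<close>, \<open>rep\<close> undoes \<open>tensor_map\<close>: both are
  additive there, and \<open>rep_tensor\<close> is the case of a generator. This is what makes the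
  induced map on cosets injective.\<close>

lemma rep_tensor_map:
  assumes "in_F u" shows "u - rep (tensor_map u) \<in> H"
  using assms
proof (induction u rule: free_Abelian_group_induct[consumes 1, case_names zero diff frag])
  case zero
  have "supp \<zero>\<^bsub>T\<^esub> = {}" by (auto simp: supp_def)
  then show ?case by (simp add: tensor_map_zero rep_def)
next
  case (diff x y)
  have "rep (tensor_map x) - rep (tensor_map (x - y)) - rep (tensor_map y) \<in> H"
    using rep_add[of "tensor_map (x - y)" "tensor_map y"] diff
    by (simp add: tensor_map_diff_add in_F_diff)
  moreover have "x - y - rep (tensor_map (x - y)) = (x - rep (tensor_map x)) - (y - rep (tensor_map y))
    + (rep (tensor_map x) - rep (tensor_map (x - y)) - rep (tensor_map y))"
    by simp
  ultimately show ?case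
    using diff H_add H_diff by presburger
next
  case (frag a)
  then show ?case
    using rep_tensor by (auto simp: tensor_map_frag_of)
qed

text \<open>If \<open>tensor_map u\<close> is zero, its representative is the empty sum, and
  \<open>rep_tensor_map\<close> puts \<open>u\<close> itself in \<open>H\<close>.\<close>

lemma mem_H_iff: "u \<in> H \<longleftrightarrow> in_F u \<and> tensor_map u = \<zero>\<^bsub>T\<^esub>"
proof
  assume u: "in_F u \<and> tensor_map u = \<zero>\<^bsub>T\<^esub>"
  have "supp \<zero>\<^bsub>T\<^esub> = {}" by (auto simp: supp_def)
  then show "u \<in> H"
    using rep_tensor_map[of u] u by (simp add: rep_def)
qed (use tensor_map_H H_keys in auto)

text \<open>Cosets are the fibres of \<open>tensor_map\<close> within \<open>F\<close>, since
  \<open>H\<close> is its kernel.\<close>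

lemma coset_eq:
  assumes u: "in_F u" shows "H #>\<^bsub>F\<^esub> u = {v. in_F v \<and> tensor_map v = tensor_map u}"
proof (intro equalityI subsetI)
  fix v assume "v \<in> H #>\<^bsub>F\<^esub> u"
  then obtain h where "h \<in> H" "v = h + u"
    by (auto simp: r_coset_def)
  then show "v \<in> {v. in_F v \<and> tensor_map v = tensor_map u}"
    using u H_keys[of h] by (simp add: tensor_map_add tensor_map_H in_F_add)
next
  fix v assume v: "v \<in> {v. in_F v \<and> tensor_map v = tensor_map u}"
  then have "v - u \<in> H"
    using u by (simp add: mem_H_iff tensor_map_diff in_F_diff T.M.minus_eq T.M.r_neg)
  then show "v \<in> H #>\<^bsub>F\<^esub> u"
    by (force simp: r_coset_def)
qed

lemma tensor_map_surj:
  assumes "f \<in> carrier T" shows "\<exists>u. in_F u \<and> tensor_map u = f"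
  using assms
proof (induction rule: T_induct)
  case (single m g)
  then show ?case
    by (intro exI[of _ "frag_of (m, basis g)"]) (simp add: keys_frag_of tensor_map_frag_of single_act)
next
  case (add f f')
  then show ?case
    using in_F_add tensor_map_add by metis
qed

text \<open>Linearity of \<open>tensor_map\<close> over \<open>S\<close>. Membership in
  \<open>F\<close> is proved along with it because the induction step for differences needs
  both.\<close>

lemma frag_act:
  assumes u: "in_F u" and t: "t \<in> carrier S"
  shows "in_F (frag_extend (\<lambda>(x, s). frag_of (x, s \<otimes>\<^bsub>S\<^esub> t)) u) \<and>
    tensor_map (frag_extend (\<lambda>(x, s). frag_of (x, s \<otimes>\<^bsub>S\<^esub> t)) u) = tensor_map u \<star>\<^bsub>T\<^esub> t"
  using u
proof (induction u rule: free_Abelian_group_induct[consumes 1, case_names zero diff frag])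
  case zero
  then show ?case using t by (simp add: tensor_map_zero)
next
  case (diff x y)
  then show ?case
    using t by (simp add: frag_extend_diff tensor_map_diff in_F_diff T.M.minus_eq act_add_vector T.rsmult_minus_vector)
next
  case (frag a)
  then show ?case
    using t by (auto simp: keys_frag_of tensor_map_frag_of act_assoc)
qed

section \<open>Comparison of the induced module with its model\<close>

abbreviation "E \<equiv> induced_module R G \<sigma> c M"

lemma carrier_E: "carrier E = (\<lambda>u. H #>\<^bsub>F\<^esub> u) ` {u. in_F u}"
  by (auto simp: induced_module_def extend_scalars_def Let_def FactGroup_def RCOSETS_def)

lemma zero_E: "\<zero>\<^bsub>E\<^esub> = H #>\<^bsub>F\<^esub> 0"
  by (auto simp: induced_module_def extend_scalars_def Let_def FactGroup_def r_coset_def)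

lemma add_E:
  assumes "in_F u" "in_F v"
  shows "(H #>\<^bsub>F\<^esub> u) \<oplus>\<^bsub>E\<^esub> (H #>\<^bsub>F\<^esub> v) = H #>\<^bsub>F\<^esub> (u + v)"
proof -
  have "H \<lhd> F"
    using subgroup_H comm_group.normal_iff_subgroup[OF abelian_free_Abelian_group] by blast
  from normal.rcos_sum[OF this, of u v] show ?thesis
    using assms by (simp add: induced_module_def extend_scalars_def Let_def FactGroup_def)
qed

text \<open>Two elements of one coset have the same value under \<open>tensor_map\<close>; by
  \<open>frag_act\<close> so do their images, so all cosets in the union coincide.\<close>

lemma smult_E:
  assumes u: "in_F u" and t: "t \<in> carrier S"
  shows "(H #>\<^bsub>F\<^esub> u) \<star>\<^bsub>E\<^esub> t = H #>\<^bsub>F\<^esub> frag_extend (\<lambda>(x, s). frag_of (x, s \<otimes>\<^bsub>S\<^esub> t)) u"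
proof -
  have "H #>\<^bsub>F\<^esub> frag_extend (\<lambda>(x, s). frag_of (x, s \<otimes>\<^bsub>S\<^esub> t)) v
      = H #>\<^bsub>F\<^esub> frag_extend (\<lambda>(x, s). frag_of (x, s \<otimes>\<^bsub>S\<^esub> t)) u" if "v \<in> H #>\<^bsub>F\<^esub> u" for v
    using that u t frag_act[OF u t] frag_act[of v t] by (simp add: coset_eq)
  moreover have "u \<in> H #>\<^bsub>F\<^esub> u"
    using u by (simp add: coset_eq)
  ultimately have "(\<Union>v\<in>H #>\<^bsub>F\<^esub> u. H #>\<^bsub>F\<^esub> frag_extend (\<lambda>(x, s). frag_of (x, s \<otimes>\<^bsub>S\<^esub> t)) v)
      = H #>\<^bsub>F\<^esub> frag_extend (\<lambda>(x, s). frag_of (x, s \<otimes>\<^bsub>S\<^esub> t)) u"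
    by blast
  then show ?thesis
    by (simp add: induced_module_def extend_scalars_def Let_def)
qed

text \<open>From here on primeness can be studied in the model alone.\<close>

lemma S_prime_iff: "S_prime R G \<sigma> c M \<longleftrightarrow> prime_module S T"
proof -
  \<comment> \<open>\<open>tensor_map\<close> is constant on a coset, so its image there is a
    singleton.\<close>
  define \<theta> where "\<theta> U = the_elem (tensor_map ` U)" for U
  have \<theta>: "\<theta> (H #>\<^bsub>F\<^esub> u) = tensor_map u" if "in_F u" for u
  proof -
    have "tensor_map ` (H #>\<^bsub>F\<^esub> u) = {tensor_map u}"
      using that by (auto simp: coset_eq)
    then show ?thesis by (simp add: \<theta>_def)
  qed
  show ?thesis
    unfolding S_prime_def
  proof (rule prime_module_iso_iff[OF right_module_T, of \<theta>])
    show "bij_betw \<theta> (carrier E) (carrier T)"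
      unfolding bij_betw_def
    proof
      show "inj_on \<theta> (carrier E)"
      proof (rule inj_onI)
        fix U V assume "U \<in> carrier E" "V \<in> carrier E" and eq: "\<theta> U = \<theta> V"
        then obtain u v where uv: "in_F u" "in_F v" "U = H #>\<^bsub>F\<^esub> u" "V = H #>\<^bsub>F\<^esub> v"
          by (auto simp: carrier_E)
        then have "tensor_map u = tensor_map v"
          using eq \<theta> by simp
        then show "U = V"
          using uv by (simp add: coset_eq)
      qed
      show "\<theta> ` carrier E = carrier T"
        using tensor_map_surj by (force simp: carrier_E \<theta> image_image)
    qed
  qed (use frag_act in \<open>auto simp: carrier_E zero_E add_E smult_E \<theta> in_F_add tensor_map_add tensor_map_zero\<close>)
qed

end

section \<open>Primeness\<close>

lemma (in ring) ideal_preimage: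
  assumes f: "f \<in> ring_hom R R" and I: "ideal I R"
  shows "ideal {r \<in> carrier R. f r \<in> I} R"
proof -
  interpret I: ideal I R by fact
  interpret f: ring_hom_ring R R f
    using f ring_axioms by (simp add: ring_hom_ring_def ring_hom_ring_axioms_def)
  show ?thesis
  proof (rule idealI[OF ring_axioms])
    show "subgroup {r \<in> carrier R. f r \<in> I} (add_monoid R)"
      by (rule add.subgroupI) (auto intro: exI[of _ "\<zero>"])
  qed (auto intro: I.I_l_closed I.I_r_closed)
qed

context crossed_system
begin

interpretation reg: crossed_module R G \<sigma> c "regular_module R"
  by (rule crossed_module_regular)

lemma sigma_surj:
  assumes "pointwise_surjective R G \<sigma>" "g \<in> carrier G" "r \<in> carrier R"
  obtains r' where "r' \<in> carrier R" "\<sigma> g r' = r"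
  using assms unfolding pointwise_surjective_def by (metis imageE)

text \<open>The ascending chain is that of the preimages of \<open>B\<close> under the powers of \<open>\<sigma> g\<close>.\<close>

lemma G_invariant_of_stable:
  assumes acc: "acc_ideals R" and surj: "pointwise_surjective R G \<sigma>" and B: "ideal B R"
    and stable: "\<And>g b. \<lbrakk>g \<in> carrier G; b \<in> B\<rbrakk> \<Longrightarrow> \<sigma> g b \<in> B"
  shows "G_invariant R G \<sigma> B"
  unfolding G_invariant_def
proof
  fix g assume g: "g \<in> carrier G"
  have sub: "B \<subseteq> carrier R"
    using B by (simp add: additive_subgroup.a_subset ideal.axioms(1))
  define I where "I n = {r \<in> carrier R. (\<sigma> g ^^ n) r \<in> B}" for n
  have pow_closed: "(\<sigma> g ^^ n) r \<in> carrier R" if "r \<in> carrier R" for n r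
    using that g by (induction n) auto
  have "ideal (I n) R" for n
  proof (induction n)
    case 0
    have "I 0 = B" using sub by (auto simp: I_def)
    then show ?case using B by simp
  next
    case (Suc n)
    have "I (Suc n) = {r \<in> carrier R. \<sigma> g r \<in> I n}"
      using g by (auto simp: I_def funpow_swap1)
    then show ?case
      using R.ideal_preimage[OF sigma_hom[OF g] Suc] by simp
  qed
  moreover have "I n \<subseteq> I (Suc n)" for n
    using g stable by (auto simp: I_def)
  ultimately obtain N where N: "\<And>n. n \<ge> N \<Longrightarrow> I n = I N"
    using acc unfolding acc_ideals_def by metis
  have pow_surj: "\<exists>y\<in>carrier R. (\<sigma> g ^^ n) y = x" if "x \<in> carrier R" for n x
    using that
  proof (induction n arbitrary: x)
    case (Suc n)
    then obtain x' where "x' \<in> carrier R" "\<sigma> g x' = x"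
      using sigma_surj[OF surj g] by metis
    then show ?case
      using Suc.IH by (metis comp_apply funpow.simps(2))
  qed auto
  show "{r \<in> carrier R. \<sigma> g r \<in> B} = B"
  proof (intro equalityI subsetI)
    fix x assume "x \<in> {r \<in> carrier R. \<sigma> g r \<in> B}"
    then have x: "x \<in> carrier R" "\<sigma> g x \<in> B" by auto
    \<comment> \<open>With \<open>x\<close> written as the \<open>N\<close>-th iterated image of
      \<open>y\<close>, the assumption says that \<open>y\<close> lies in \<open>I (Suc N)\<close>.
      This equals \<open>I N\<close>, and membership there means that \<open>x\<close> is in
      \<open>B\<close>.\<close>
    obtain y where y: "y \<in> carrier R" "(\<sigma> g ^^ N) y = x"
      using pow_surj x by blast
    then have "y \<in> I (Suc N)"
      using x by (simp add: I_def)
    then have "y \<in> I N"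
      using N[of "Suc N"] by simp
    then show "x \<in> B"
      using y by (simp add: I_def)
  qed (use sub stable g in auto)
qed

end

section \<open>Twisted annihilators of an element\<close>

context crossed_module
begin

interpretation S: ring S by (rule ring_crossed_product)
interpretation T: right_module S T by (rule right_module_T)

text \<open>For \<open>K = carrier G\<close> this is (ann (m R) : G). The set \<open>K\<close> is a
  parameter because the final argument controls only the twists by the elements \<open>g k\<close>
  with \<open>g\<close> fixed.\<close>

definition twisted_ann :: "'m \<Rightarrow> 'g set \<Rightarrow> 'r set"
  where "twisted_ann m K = {b \<in> carrier R. \<forall>h\<in>K. \<forall>r\<in>carrier R. m \<star>\<^bsub>M\<^esub> (r \<otimes>\<^bsub>R\<^esub> \<sigma> h b) = \<zero>\<^bsub>M\<^esub>}"

text \<open>A left factor of \<open>b\<close> is twisted and absorbed into the arbitrary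
  \<open>r\<close>; a right factor acts on an element that is already zero.\<close>

lemma twisted_ann_ideal:
  assumes m: "m \<in> carrier M" and K: "K \<subseteq> carrier G"
  shows "ideal (twisted_ann m K) R"
proof (rule idealI[OF R.ring_axioms])
  have KG: "h \<in> carrier G" if "h \<in> K" for h using K that by auto
  have minus: "\<sigma> h (\<ominus>\<^bsub>R\<^esub> b) = \<ominus>\<^bsub>R\<^esub> \<sigma> h b" if "h \<in> carrier G" "b \<in> carrier R" for h b
    using that
    by (metis R.add.inv_closed R.l_neg R.minus_equality sigma_add sigma_closed sigma_zero)
  show "subgroup (twisted_ann m K) (add_monoid R)"
  proof (rule R.add.subgroupI)
    show "twisted_ann m K \<noteq> {}"
      using m KG by (auto simp: twisted_ann_def intro!: exI[of _ "\<zero>\<^bsub>R\<^esub>"])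
  qed (use m KG in \<open>auto simp: twisted_ann_def sigma_add minus R.r_distr R.r_minus rsmult_add_scalar rsmult_minus_scalar\<close>)
  fix b x assume b: "b \<in> twisted_ann m K" and x: "x \<in> carrier R"
  have "m \<star>\<^bsub>M\<^esub> (r \<otimes>\<^bsub>R\<^esub> \<sigma> h (x \<otimes>\<^bsub>R\<^esub> b)) = \<zero>\<^bsub>M\<^esub>" if "h \<in> K" "r \<in> carrier R" for h r
  proof -
    have "m \<star>\<^bsub>M\<^esub> ((r \<otimes>\<^bsub>R\<^esub> \<sigma> h x) \<otimes>\<^bsub>R\<^esub> \<sigma> h b) = \<zero>\<^bsub>M\<^esub>"
      using b x that KG by (simp add: twisted_ann_def)
    then show ?thesis
      using b x that KG by (simp add: twisted_ann_def sigma_mult R.m_assoc)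
  qed
  then show "x \<otimes>\<^bsub>R\<^esub> b \<in> twisted_ann m K"
    using b x by (simp add: twisted_ann_def)
  have "m \<star>\<^bsub>M\<^esub> (r \<otimes>\<^bsub>R\<^esub> \<sigma> h (b \<otimes>\<^bsub>R\<^esub> x)) = \<zero>\<^bsub>M\<^esub>" if "h \<in> K" "r \<in> carrier R" for h r
  proof -
    have "m \<star>\<^bsub>M\<^esub> ((r \<otimes>\<^bsub>R\<^esub> \<sigma> h b) \<otimes>\<^bsub>R\<^esub> \<sigma> h x) = \<zero>\<^bsub>M\<^esub>"
      using b x m that KG by (subst rsmult_assoc) (auto simp: twisted_ann_def)
    then show ?thesis
      using b x that KG by (simp add: twisted_ann_def sigma_mult R.m_assoc)
  qed
  then show "b \<otimes>\<^bsub>R\<^esub> x \<in> twisted_ann m K"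
    using b x by (simp add: twisted_ann_def)
qed

text \<open>By the twist law, the twist by \<open>g\<close> and then by \<open>h\<close> is the
  twist by the product \<open>h g\<close>, again in \<open>K\<close>, up to the unit
  \<open>c h g\<close>, which cancels.\<close>

lemma twisted_ann_stable:
  assumes m: "m \<in> carrier M" and K: "K \<subseteq> carrier G"
    and KG: "\<And>h g. \<lbrakk>h \<in> K; g \<in> carrier G\<rbrakk> \<Longrightarrow> h \<otimes>\<^bsub>G\<^esub> g \<in> K"
    and g: "g \<in> carrier G" and b: "b \<in> twisted_ann m K"
  shows "\<sigma> g b \<in> twisted_ann m K"
proof -
  have bR: "b \<in> carrier R" using b by (simp add: twisted_ann_def)
  have "m \<star>\<^bsub>M\<^esub> (r \<otimes>\<^bsub>R\<^esub> \<sigma> h (\<sigma> g b)) = \<zero>\<^bsub>M\<^esub>" if h: "h \<in> K" and r: "r \<in> carrier R" for h r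
  proof (rule rsmult_unit_eq_zero)
    have hG: "h \<in> carrier G" using h K by auto
    show "c h g \<in> Units R" using c_unit hG g by simp
    have "(m \<star>\<^bsub>M\<^esub> (r \<otimes>\<^bsub>R\<^esub> \<sigma> h (\<sigma> g b))) \<star>\<^bsub>M\<^esub> c h g = m \<star>\<^bsub>M\<^esub> (r \<otimes>\<^bsub>R\<^esub> (\<sigma> h (\<sigma> g b) \<otimes>\<^bsub>R\<^esub> c h g))"
      using m r hG g bR by (simp add: R.m_assoc flip: rsmult_assoc)
    also have "\<dots> = m \<star>\<^bsub>M\<^esub> ((r \<otimes>\<^bsub>R\<^esub> c h g) \<otimes>\<^bsub>R\<^esub> \<sigma> (h \<otimes>\<^bsub>G\<^esub> g) b)"
      using m r hG g bR by (simp add: sigma_twist R.m_assoc)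
    also have "\<dots> = \<zero>\<^bsub>M\<^esub>"
      using b r hG g h KG by (simp add: twisted_ann_def)
    finally show "(m \<star>\<^bsub>M\<^esub> (r \<otimes>\<^bsub>R\<^esub> \<sigma> h (\<sigma> g b))) \<star>\<^bsub>M\<^esub> c h g = \<zero>\<^bsub>M\<^esub>" .
  qed (use m r h g bR K in auto)
  then show ?thesis
    using g bR by (simp add: twisted_ann_def)
qed

lemma twisted_ann_carrier_ann:
  assumes "m \<in> carrier M" "b \<in> twisted_ann m (carrier G)"
  shows "m \<star>\<^bsub>M\<^esub> b = \<zero>\<^bsub>M\<^esub>"
proof -
  have "m \<star>\<^bsub>M\<^esub> (\<one>\<^bsub>R\<^esub> \<otimes>\<^bsub>R\<^esub> \<sigma> \<one>\<^bsub>G\<^esub> b) = \<zero>\<^bsub>M\<^esub>" and "b \<in> carrier R"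
    using assms by (auto simp: twisted_ann_def simp del: R.l_one)
  then show ?thesis
    by (simp add: sigma_one)
qed

section \<open>Conditions (2), (3) and (4) and their equivalence\<close>

definition elementwise_prime :: bool
  where "elementwise_prime \<longleftrightarrow> (\<forall>m\<in>carrier M. \<forall>b\<in>carrier R.
    (\<forall>h\<in>carrier G. \<forall>r\<in>carrier R. m \<star>\<^bsub>M\<^esub> (r \<otimes>\<^bsub>R\<^esub> \<sigma> h b) = \<zero>\<^bsub>M\<^esub>) \<longrightarrow>
    m = \<zero>\<^bsub>M\<^esub> \<or> (\<forall>x\<in>carrier M. x \<star>\<^bsub>M\<^esub> b = \<zero>\<^bsub>M\<^esub>))"

definition idealwise_prime :: bool
  where "idealwise_prime \<longleftrightarrow> (\<forall>m\<in>carrier M. \<forall>B. ideal B R \<and> G_invariant R G \<sigma> B \<and>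
    (\<forall>b\<in>B. m \<star>\<^bsub>M\<^esub> b = \<zero>\<^bsub>M\<^esub>) \<longrightarrow>
    m = \<zero>\<^bsub>M\<^esub> \<or> (\<forall>x\<in>carrier M. \<forall>b\<in>B. x \<star>\<^bsub>M\<^esub> b = \<zero>\<^bsub>M\<^esub>))"

definition core_prime :: bool
  where "core_prime \<longleftrightarrow> (\<forall>N. submodule N R M \<and> N \<noteq> {\<zero>\<^bsub>M\<^esub>} \<longrightarrow>
    G_core R G \<sigma> (ann R M N) = G_core R G \<sigma> (ann R M (carrier M)))"

lemma elementwise_primeD:
  assumes "elementwise_prime" "m \<in> carrier M" "m \<noteq> \<zero>\<^bsub>M\<^esub>" "b \<in> twisted_ann m (carrier G)" "x \<in> carrier M"
  shows "x \<star>\<^bsub>M\<^esub> b = \<zero>\<^bsub>M\<^esub>"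
  using assms unfolding elementwise_prime_def twisted_ann_def by blast

text \<open>An invariant ideal that kills \<open>m\<close> lies in
  \<open>twisted_ann m (carrier G)\<close>. Conversely that set is itself an invariant ideal killing
  \<open>m\<close>, so (3) applies to it.\<close>

lemma elementwise_prime_iff_idealwise_prime:
  assumes "acc_ideals R" "pointwise_surjective R G \<sigma>"
  shows "elementwise_prime \<longleftrightarrow> idealwise_prime"
proof
  assume el: elementwise_prime
  show idealwise_prime
    unfolding idealwise_prime_def
  proof (intro ballI allI impI disjCI)
    fix m B x b
    assume m: "m \<in> carrier M" and B: "ideal B R \<and> G_invariant R G \<sigma> B \<and> (\<forall>b\<in>B. m \<star>\<^bsub>M\<^esub> b = \<zero>\<^bsub>M\<^esub>)"
      and nz: "\<not> (\<forall>x\<in>carrier M. \<forall>b\<in>B. x \<star>\<^bsub>M\<^esub> b = \<zero>\<^bsub>M\<^esub>)"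
    interpret B: ideal B R using B by simp
    have "b \<in> twisted_ann m (carrier G)" if b: "b \<in> B" for b
    proof -
      have "\<sigma> h b \<in> B" if "h \<in> carrier G" for h
        using B b that by (auto simp: G_invariant_def)
      then show ?thesis
        using B b by (auto simp: twisted_ann_def B.I_l_closed B.a_Hcarr)
    qed
    then show "m = \<zero>\<^bsub>M\<^esub>"
      using elementwise_primeD[OF el m] nz by blast
  qed
next
  assume id: idealwise_prime
  show elementwise_prime
    unfolding elementwise_prime_def
  proof (intro ballI impI)
    fix m b
    assume m: "m \<in> carrier M" and b: "b \<in> carrier R"
      and *: "\<forall>h\<in>carrier G. \<forall>r\<in>carrier R. m \<star>\<^bsub>M\<^esub> (r \<otimes>\<^bsub>R\<^esub> \<sigma> h b) = \<zero>\<^bsub>M\<^esub>"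
    let ?B = "twisted_ann m (carrier G)"
    have "ideal ?B R"
      using twisted_ann_ideal m by simp
    moreover have "G_invariant R G \<sigma> ?B"
      by (rule G_invariant_of_stable[OF assms \<open>ideal ?B R\<close>]) (rule twisted_ann_stable; use m in simp)
    moreover have "\<forall>b\<in>?B. m \<star>\<^bsub>M\<^esub> b = \<zero>\<^bsub>M\<^esub>"
      using twisted_ann_carrier_ann m by simp
    moreover have "b \<in> ?B"
      using b * by (simp add: twisted_ann_def)
    ultimately show "m = \<zero>\<^bsub>M\<^esub> \<or> (\<forall>x\<in>carrier M. x \<star>\<^bsub>M\<^esub> b = \<zero>\<^bsub>M\<^esub>)"
      using id m unfolding idealwise_prime_def by blast
  qed
qed

lemma G_core_ann_cyclic:
  assumes "m \<in> carrier M"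
  shows "G_core R G \<sigma> (ann R M ((\<lambda>a. m \<star>\<^bsub>M\<^esub> a) ` carrier R)) = twisted_ann m (carrier G)"
  using assms by (auto simp: G_core_def ann_def twisted_ann_def rsmult_assoc)

text \<open>For a nonzero \<open>m\<close> in \<open>N\<close>, the core of the annihilator of
  \<open>N\<close> lies in \<open>twisted_ann m (carrier G)\<close>, which is stable under all
  twists and kills \<open>M\<close> by (2). Conversely (4) is applied to the cyclic submodule of
  \<open>m\<close>.\<close>

lemma elementwise_prime_iff_core_prime: "elementwise_prime \<longleftrightarrow> core_prime"
proof
  assume el: elementwise_prime
  show core_prime
    unfolding core_prime_def
  proof (intro allI impI)
    fix N assume N: "submodule N R M \<and> N \<noteq> {\<zero>\<^bsub>M\<^esub>}"
    interpret N: submodule N R M using N by simp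
    have sub: "N \<subseteq> carrier M" using N.subset by simp
    obtain m where m: "m \<in> N" "m \<noteq> \<zero>\<^bsub>M\<^esub>"
      using N N.one_closed by auto
    then have mM: "m \<in> carrier M" using sub by auto
    have "(\<lambda>a. m \<star>\<^bsub>M\<^esub> a) ` carrier R \<subseteq> N"
      using m N.smult_closed by auto
    then have "G_core R G \<sigma> (ann R M N) \<subseteq> twisted_ann m (carrier G)"
      unfolding G_core_ann_cyclic[OF mM, symmetric] by (auto simp: G_core_def ann_def)
    moreover have "\<sigma> g b \<in> twisted_ann m (carrier G)"
      if "b \<in> twisted_ann m (carrier G)" "g \<in> carrier G" for b g
      by (rule twisted_ann_stable) (use that mM in auto)
    ultimately have "x \<star>\<^bsub>M\<^esub> \<sigma> g b = \<zero>\<^bsub>M\<^esub>"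
      if "b \<in> G_core R G \<sigma> (ann R M N)" "g \<in> carrier G" "x \<in> carrier M" for b g x
      using elementwise_primeD[OF el mM m(2)] that by blast
    then show "G_core R G \<sigma> (ann R M N) = G_core R G \<sigma> (ann R M (carrier M))"
      using sub by (auto simp: G_core_def ann_def)
  qed
next
  assume core: core_prime
  show elementwise_prime
    unfolding elementwise_prime_def
  proof (intro ballI impI disjCI)
    fix m b
    assume m: "m \<in> carrier M" and b: "b \<in> carrier R"
      and *: "\<forall>h\<in>carrier G. \<forall>r\<in>carrier R. m \<star>\<^bsub>M\<^esub> (r \<otimes>\<^bsub>R\<^esub> \<sigma> h b) = \<zero>\<^bsub>M\<^esub>"
      and nz: "\<not> (\<forall>x\<in>carrier M. x \<star>\<^bsub>M\<^esub> b = \<zero>\<^bsub>M\<^esub>)"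
    show "m = \<zero>\<^bsub>M\<^esub>"
    proof (rule ccontr)
      assume m0: "m \<noteq> \<zero>\<^bsub>M\<^esub>"
      let ?N = "(\<lambda>a. m \<star>\<^bsub>M\<^esub> a) ` carrier R"
      have "m \<star>\<^bsub>M\<^esub> \<one>\<^bsub>R\<^esub> \<in> ?N" by blast
      then have "?N \<noteq> {\<zero>\<^bsub>M\<^esub>}"
        using m m0 by auto
      then have "G_core R G \<sigma> (ann R M (carrier M)) = twisted_ann m (carrier G)"
        using core submodule_cyclic[OF m] G_core_ann_cyclic[OF m] by (simp add: core_prime_def)
      then have "b \<in> G_core R G \<sigma> (ann R M (carrier M))"
        using b * by (simp add: twisted_ann_def)
      then have "\<sigma> \<one>\<^bsub>G\<^esub> b \<in> ann R M (carrier M)"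
        by (auto simp: G_core_def)
      then show False
        using nz b by (simp add: sigma_one ann_def)
    qed
  qed
qed

section \<open>Primeness of the model and the conditions on the coefficients\<close>

lemma single_eq_zero_iff:
  "g \<in> carrier G \<Longrightarrow> cp_single M G m g = \<zero>\<^bsub>T\<^esub> \<longleftrightarrow> m = \<zero>\<^bsub>M\<^esub>"
proof
  assume "g \<in> carrier G" "cp_single M G m g = \<zero>\<^bsub>T\<^esub>"
  then have "cp_single M G m g g = \<zero>\<^bsub>T\<^esub> g" by simp
  then show "m = \<zero>\<^bsub>M\<^esub>"
    using \<open>g \<in> carrier G\<close> by simp
next
  assume "g \<in> carrier G" "m = \<zero>\<^bsub>M\<^esub>"
  then show "cp_single M G m g = \<zero>\<^bsub>T\<^esub>"
    by (intro T_ext) auto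
qed

text \<open>Acting by \<open>r g\<close> and then by \<open>b\<close> on m tensor 1 gives the
  coefficient m r b^g at \<open>g\<close>. So \<open>b\<close> kills the nonzero submodule generated
  by m tensor 1, hence by primeness also x tensor 1.\<close>

lemma prime_imp_elementwise_prime:
  assumes "prime_module S T"
  shows elementwise_prime
  unfolding elementwise_prime_def disj_imp
proof (intro ballI impI)
  interpret P: prime_module S T by fact
  fix m b x
  assume m: "m \<in> carrier M" and b: "b \<in> carrier R"
    and *: "\<forall>h\<in>carrier G. \<forall>r\<in>carrier R. m \<star>\<^bsub>M\<^esub> (r \<otimes>\<^bsub>R\<^esub> \<sigma> h b) = \<zero>\<^bsub>M\<^esub>"
    and nz: "m \<noteq> \<zero>\<^bsub>M\<^esub>" and x: "x \<in> carrier M"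
  let ?m = "cp_single M G m \<one>\<^bsub>G\<^esub>" and ?b = "cp_single R G b \<one>\<^bsub>G\<^esub>"
  let ?N = "(\<lambda>s. ?m \<star>\<^bsub>T\<^esub> s) ` carrier S"
  have "?m \<star>\<^bsub>T\<^esub> \<one>\<^bsub>S\<^esub> \<in> ?N"
    using S.one_closed by blast
  moreover have "?m \<star>\<^bsub>T\<^esub> \<one>\<^bsub>S\<^esub> \<noteq> \<zero>\<^bsub>T\<^esub>"
    using m nz by (simp add: single_eq_zero_iff)
  ultimately have "?N \<noteq> {\<zero>\<^bsub>T\<^esub>}"
    by blast
  then have ann: "ann S T ?N = ann S T (carrier T)"
    using P.ann_eq T.submodule_cyclic m by simp
  have "(?m \<star>\<^bsub>T\<^esub> s) \<star>\<^bsub>T\<^esub> ?b = \<zero>\<^bsub>T\<^esub>" if "s \<in> carrier S" for s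
    using that
  proof (induction rule: crossed_product_induct)
    case (single r g)
    then have "(?m \<star>\<^bsub>T\<^esub> cp_single R G r g) \<star>\<^bsub>T\<^esub> ?b
        = cp_single M G (m \<star>\<^bsub>M\<^esub> (r \<otimes>\<^bsub>R\<^esub> \<sigma> g b)) g"
      using m b by (simp add: single_act_single sigma_one c_one_left c_one_right rsmult_assoc)
    then show ?case
      using * single by (simp add: single_eq_zero_iff)
  next
    case (add s t)
    then show ?case
      using m b by (simp add: act_add_scalar act_add_vector)
  qed
  then have "?b \<in> ann S T (carrier T)"
    using b unfolding ann[symmetric] by (auto simp: ann_def)
  then have "cp_single M G x \<one>\<^bsub>G\<^esub> \<star>\<^bsub>T\<^esub> ?b = \<zero>\<^bsub>T\<^esub>"
    using x by (simp add: ann_def)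
  then show "x \<star>\<^bsub>M\<^esub> b = \<zero>\<^bsub>M\<^esub>"
    using x b by (simp add: single_act single_eq_zero_iff)
qed

text \<open>At a product attained only once, the convolution sum has a single term. The points
  \<open>g\<close> and \<open>h\<close> may lie outside the supports; the term is then zero.\<close>

lemma act_unique:
  assumes f: "f \<in> carrier T" and s: "s \<in> carrier S" and g: "g \<in> carrier G" and h: "h \<in> carrier G"
    and uniq: "\<And>g' h'. \<lbrakk>g' \<in> supp f; h' \<in> supp_S s; g' \<otimes>\<^bsub>G\<^esub> h' = g \<otimes>\<^bsub>G\<^esub> h\<rbrakk> \<Longrightarrow> g' = g \<and> h' = h"
  shows "(f \<star>\<^bsub>T\<^esub> s) (g \<otimes>\<^bsub>G\<^esub> h) = f g \<star>\<^bsub>M\<^esub> (\<sigma> g (s h) \<otimes>\<^bsub>R\<^esub> c g h)"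
proof -
  have "(f \<star>\<^bsub>T\<^esub> s) (g \<otimes>\<^bsub>G\<^esub> h)
      = finsum M (\<lambda>(g, h). f g \<star>\<^bsub>M\<^esub> (\<sigma> g (s h) \<otimes>\<^bsub>R\<^esub> c g h)) {(g, h)}"
    by (rule act_eq_finsum[OF f s]) (use g h uniq in auto)
  then show ?thesis
    using f s g h by simp
qed

lemma supp_S_single: "supp_S (cp_single R G r h) \<subseteq> {h}"
  by (auto simp: supp_S_def split: if_splits)

text \<open>Acting by a single term cannot increase the number of nonzero coefficients, so
  translates inherit minimality of the support.\<close>

lemma supp_act_single:
  assumes f: "f \<in> carrier T" and r: "r \<in> carrier R" and h: "h \<in> carrier G"
  shows "supp (f \<star>\<^bsub>T\<^esub> cp_single R G r h) \<subseteq> (\<lambda>g. g \<otimes>\<^bsub>G\<^esub> h) ` supp f"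
proof
  fix k assume k: "k \<in> supp (f \<star>\<^bsub>T\<^esub> cp_single R G r h)"
  show "k \<in> (\<lambda>g. g \<otimes>\<^bsub>G\<^esub> h) ` supp f"
  proof (rule ccontr)
    assume "k \<notin> (\<lambda>g. g \<otimes>\<^bsub>G\<^esub> h) ` supp f"
    then have "(f \<star>\<^bsub>T\<^esub> cp_single R G r h) k = \<zero>\<^bsub>M\<^esub>"
      using k f r h supp_S_single[of r h]
      by (intro act_eq_zero) (auto simp: supp_def)
    then show False
      using k by (simp add: supp_def)
  qed
qed

lemma act_scalar:
  assumes f: "f \<in> carrier T" and r: "r \<in> carrier R" and g: "g \<in> carrier G"
  shows "(f \<star>\<^bsub>T\<^esub> cp_single R G r \<one>\<^bsub>G\<^esub>) g = f g \<star>\<^bsub>M\<^esub> \<sigma> g r"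
proof -
  have "g' = g \<and> h' = \<one>\<^bsub>G\<^esub>"
    if "g' \<in> supp f" "h' \<in> supp_S (cp_single R G r \<one>\<^bsub>G\<^esub>)" "g' \<otimes>\<^bsub>G\<^esub> h' = g \<otimes>\<^bsub>G\<^esub> \<one>\<^bsub>G\<^esub>" for g' h'
    using that g supp_S_single[of r "\<one>\<^bsub>G\<^esub>"] by (auto simp: supp_def)
  from act_unique[OF f single_S[OF r G.one_closed] g G.one_closed this] show ?thesis
    using f r g by (simp add: c_one_right)
qed

lemma S_remove_coefficient:
  assumes s: "s \<in> carrier S" and h: "h \<in> carrier G"
  obtains s' where "s' \<in> carrier S" "s = cp_single R G (s h) h \<oplus>\<^bsub>S\<^esub> s'"
    "supp_S s' = supp_S s - {h}" "\<And>k. \<lbrakk>k \<in> carrier G; k \<noteq> h\<rbrakk> \<Longrightarrow> s' k = s k"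
proof
  let ?s' = "\<lambda>k\<in>carrier G. if k = h then \<zero>\<^bsub>R\<^esub> else s k"
  show supp: "supp_S ?s' = supp_S s - {h}"
    by (auto simp: supp_S_def)
  have "finite (supp_S ?s')"
    unfolding supp using s by simp
  moreover have "?s' \<in> carrier G \<rightarrow>\<^sub>E carrier R"
    using s by auto
  ultimately show "?s' \<in> carrier S"
    unfolding S_mem_iff by simp
  show "s = cp_single R G (s h) h \<oplus>\<^bsub>S\<^esub> ?s'"
    by (rule T_ext) (use s h in auto)
qed simp

text \<open>
  A unique product \<open>g h\<close> of the supports makes \<open>f r s\<^sub>h\<close> vanish at \<open>g\<close>, so \<open>f r s\<^sub>h = 0\<close> by the
  minimality of the support of \<open>f\<close>; then the term at \<open>h\<close> can be removed from \<open>s\<close>.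
\<close>

lemma minimal_support_annihilates_coefficients:
  assumes upm: "unique_product_monoid G" and N: "submodule N S T"
    and f: "f \<in> N" "f \<noteq> \<zero>\<^bsub>T\<^esub>"
    and min: "\<And>f'. \<lbrakk>f' \<in> N; card (supp f') < card (supp f)\<rbrakk> \<Longrightarrow> f' = \<zero>\<^bsub>T\<^esub>"
    and s: "s \<in> carrier S"
    and ann: "\<And>r. r \<in> carrier R \<Longrightarrow> (f \<star>\<^bsub>T\<^esub> cp_single R G r \<one>\<^bsub>G\<^esub>) \<star>\<^bsub>T\<^esub> s = \<zero>\<^bsub>T\<^esub>"
    and h: "h \<in> carrier G" and r: "r \<in> carrier R"
  shows "f \<star>\<^bsub>T\<^esub> cp_single R G (r \<otimes>\<^bsub>R\<^esub> s h) \<one>\<^bsub>G\<^esub> = \<zero>\<^bsub>T\<^esub>"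
  using s ann
\<comment> \<open>Only \<open>s\<close> varies, and its annihilation hypothesis travels with it;
  \<open>f\<close>, \<open>h\<close> and \<open>r\<close> stay fixed.\<close>
proof (induction "card (supp_S s)" arbitrary: s rule: less_induct)
  case less
  interpret N: submodule N S T by fact
  have fT: "f \<in> carrier T"
    using f N.subset by auto
  have supp_f: "supp f \<noteq> {}"
  proof
    assume "supp f = {}"
    then have "f = \<zero>\<^bsub>T\<^esub>"
      using fT by (intro T_ext) (auto simp: supp_def)
    then show False using f by simp
  qed
  show ?case
  proof (cases "h \<in> supp_S s")
    case False
    then have "s h = \<zero>\<^bsub>R\<^esub>"
      using h by (simp add: supp_S_def)
    moreover have "cp_single R G \<zero>\<^bsub>R\<^esub> \<one>\<^bsub>G\<^esub> = \<zero>\<^bsub>S\<^esub>"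
      by (rule T_ext) auto
    ultimately show ?thesis
      using r fT by simp
  next
    case True
    then have "\<exists>x\<in>supp f. \<exists>y\<in>supp_S s. \<forall>x'\<in>supp f. \<forall>y'\<in>supp_S s.
        (x', y') \<noteq> (x, y) \<longrightarrow> x \<otimes>\<^bsub>G\<^esub> y \<noteq> x' \<otimes>\<^bsub>G\<^esub> y'"
      using supp_f fT less.prems by (intro unique_product_monoid.unique_product[OF upm]) auto
    then obtain g0 h0 where g0: "g0 \<in> supp f" and h0: "h0 \<in> supp_S s"
      and uniq: "\<And>g' h'. \<lbrakk>g' \<in> supp f; h' \<in> supp_S s; g' \<otimes>\<^bsub>G\<^esub> h' = g0 \<otimes>\<^bsub>G\<^esub> h0\<rbrakk> \<Longrightarrow> g' = g0 \<and> h' = h0"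
      by (metis prod.inject)
    have g0G: "g0 \<in> carrier G" and h0G: "h0 \<in> carrier G"
      using g0 h0 by (auto simp: supp_def supp_S_def)
    have *: "f \<star>\<^bsub>T\<^esub> cp_single R G (r \<otimes>\<^bsub>R\<^esub> s h0) \<one>\<^bsub>G\<^esub> = \<zero>\<^bsub>T\<^esub>" if r: "r \<in> carrier R" for r
    proof (rule min)
      let ?f = "f \<star>\<^bsub>T\<^esub> cp_single R G r \<one>\<^bsub>G\<^esub>" and ?f' = "f \<star>\<^bsub>T\<^esub> cp_single R G (r \<otimes>\<^bsub>R\<^esub> s h0) \<one>\<^bsub>G\<^esub>"
      have rs: "r \<otimes>\<^bsub>R\<^esub> s h0 \<in> carrier R"
        using r less.prems h0G by simp
      show "?f' \<in> N"
        using f N.smult_closed rs by simp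
      have sub: "supp (f \<star>\<^bsub>T\<^esub> cp_single R G r \<one>\<^bsub>G\<^esub>) \<subseteq> supp f" if "r \<in> carrier R" for r
        using fT that by (auto simp: supp_def act_scalar)
      \<comment> \<open>Up to the unit \<open>c g0 h0\<close>, the coefficient at \<open>g0\<close>
        of \<open>f\<close> acted on by \<open>r\<close> times \<open>s h0\<close> is the
        coefficient of a vanishing product at \<open>g0 h0\<close>.\<close>
      have "(f g0 \<star>\<^bsub>M\<^esub> \<sigma> g0 (r \<otimes>\<^bsub>R\<^esub> s h0)) \<star>\<^bsub>M\<^esub> c g0 h0 = ?f g0 \<star>\<^bsub>M\<^esub> (\<sigma> g0 (s h0) \<otimes>\<^bsub>R\<^esub> c g0 h0)"
        using fT g0G h0G r less.prems by (simp add: act_scalar sigma_mult rsmult_assoc)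
      also have "\<dots> = (?f \<star>\<^bsub>T\<^esub> s) (g0 \<otimes>\<^bsub>G\<^esub> h0)"
      proof (rule act_unique[symmetric])
        \<comment> \<open>Uniqueness was chosen for the support of \<open>f\<close>; acting by a
          scalar only shrinks it.\<close>
        show "g' = g0 \<and> h' = h0"
          if "g' \<in> supp ?f" "h' \<in> supp_S s" "g' \<otimes>\<^bsub>G\<^esub> h' = g0 \<otimes>\<^bsub>G\<^esub> h0" for g' h'
          using uniq that sub[OF r] by blast
      qed (use fT r less.prems g0G h0G in auto)
      also have "\<dots> = \<zero>\<^bsub>M\<^esub>"
        using less.prems(2)[OF r] g0G h0G by simp
      finally have "(f g0 \<star>\<^bsub>M\<^esub> \<sigma> g0 (r \<otimes>\<^bsub>R\<^esub> s h0)) \<star>\<^bsub>M\<^esub> c g0 h0 = \<zero>\<^bsub>M\<^esub>" .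
      from rsmult_unit_eq_zero[OF _ c_unit[OF g0G h0G] this]
      have "f g0 \<star>\<^bsub>M\<^esub> \<sigma> g0 (r \<otimes>\<^bsub>R\<^esub> s h0) = \<zero>\<^bsub>M\<^esub>"
        using fT g0G rs by simp
      then have "g0 \<notin> supp ?f'"
        using fT g0G rs by (simp add: supp_def act_scalar)
      then have "supp ?f' \<subset> supp f"
        using sub[OF rs] g0 by auto
      then show "card (supp ?f') < card (supp f)"
        using fT by (simp add: psubset_card_mono)
    qed
    obtain s' where s': "s' \<in> carrier S" "s = cp_single R G (s h0) h0 \<oplus>\<^bsub>S\<^esub> s'"
      "supp_S s' = supp_S s - {h0}" "\<And>k. \<lbrakk>k \<in> carrier G; k \<noteq> h0\<rbrakk> \<Longrightarrow> s' k = s k"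
      using S_remove_coefficient[OF less.prems(1) h0G] by blast
    show ?thesis
    proof (cases "h = h0")
      case True
      then show ?thesis using * r by simp
    next
      case False
      have "f \<star>\<^bsub>T\<^esub> cp_single R G (r \<otimes>\<^bsub>R\<^esub> s' h) \<one>\<^bsub>G\<^esub> = \<zero>\<^bsub>T\<^esub>"
      proof (rule less.hyps)
        show "card (supp_S s') < card (supp_S s)"
          unfolding s'(3) using h0 less.prems(1) by (intro psubset_card_mono) auto
        \<comment> \<open>The removed term acts as zero after every scalar \<open>r\<close>, because
          \<open>r\<close> and \<open>s h0\<close> combine into a scalar that kills
          \<open>f\<close>. Hence \<open>s'\<close> still satisfies the annihilation
          hypothesis.\<close>
        show "(f \<star>\<^bsub>T\<^esub> cp_single R G r \<one>\<^bsub>G\<^esub>) \<star>\<^bsub>T\<^esub> s' = \<zero>\<^bsub>T\<^esub>" if r: "r \<in> carrier R" for r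
        proof -
          let ?f = "f \<star>\<^bsub>T\<^esub> cp_single R G r \<one>\<^bsub>G\<^esub>"
          have sh: "s h0 \<in> carrier R" using less.prems h0G by simp
          have fr: "?f \<in> carrier T" using fT r by simp
          have "cp_single R G r \<one>\<^bsub>G\<^esub> \<otimes>\<^bsub>S\<^esub> cp_single R G (s h0) h0
              = cp_single R G (r \<otimes>\<^bsub>R\<^esub> s h0) \<one>\<^bsub>G\<^esub> \<otimes>\<^bsub>S\<^esub> cp_single R G \<one>\<^bsub>R\<^esub> h0"
            using r sh h0G by (simp add: cp_single_mult sigma_one c_one_left)
          then have "?f \<star>\<^bsub>T\<^esub> cp_single R G (s h0) h0
              = (f \<star>\<^bsub>T\<^esub> cp_single R G (r \<otimes>\<^bsub>R\<^esub> s h0) \<one>\<^bsub>G\<^esub>) \<star>\<^bsub>T\<^esub> cp_single R G \<one>\<^bsub>R\<^esub> h0"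
            using fT r sh h0G by (simp flip: act_assoc)
          then have "?f \<star>\<^bsub>T\<^esub> cp_single R G (s h0) h0 = \<zero>\<^bsub>T\<^esub>"
            using *[OF r] h0G by simp
          moreover have "?f \<star>\<^bsub>T\<^esub> s = ?f \<star>\<^bsub>T\<^esub> cp_single R G (s h0) h0 \<oplus>\<^bsub>T\<^esub> ?f \<star>\<^bsub>T\<^esub> s'"
            by (subst s'(2), rule act_add_scalar) (use fr sh h0G s'(1) in auto)
          ultimately show ?thesis
            using less.prems(2)[OF r] fr s'(1) by simp
        qed
      qed (use s'(1) in simp)
      then show ?thesis
        using s'(4) h False by simp
    qed
  qed
qed

text \<open>If \<open>g\<close> and \<open>g'\<close> differed, neither product of the sets {g, g'}
  and {h} would be attained only once.\<close>

lemma unique_product_r_cancel: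
  assumes upm: "unique_product_monoid G"
    and "g \<in> carrier G" "g' \<in> carrier G" "h \<in> carrier G" "g \<otimes>\<^bsub>G\<^esub> h = g' \<otimes>\<^bsub>G\<^esub> h"
  shows "g = g'"
  using unique_product_monoid.unique_product[OF upm, of "{g, g'}" "{h}"] assms(2-) by auto

lemma idealwise_prime_imp_prime:
  assumes upm: "unique_product_monoid G" and acc: "acc_ideals R" and surj: "pointwise_surjective R G \<sigma>"
    and nz: "carrier M \<noteq> {\<zero>\<^bsub>M\<^esub>}" and id: idealwise_prime
  shows "prime_module S T"
proof (intro prime_module.intro prime_module_axioms.intro right_module_T)
  obtain m where "m \<in> carrier M" "m \<noteq> \<zero>\<^bsub>M\<^esub>"
    using nz M.zero_closed by blast
  then have "cp_single M G m \<one>\<^bsub>G\<^esub> \<in> carrier T" "cp_single M G m \<one>\<^bsub>G\<^esub> \<noteq> \<zero>\<^bsub>T\<^esub>"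
    by (auto simp: single_eq_zero_iff)
  then show "carrier T \<noteq> {\<zero>\<^bsub>T\<^esub>}" by auto
next
  fix N assume N: "submodule N S T" "N \<noteq> {\<zero>\<^bsub>T\<^esub>}"
  interpret N: submodule N S T by fact
  have NT: "N \<subseteq> carrier T" using N.subset by simp
  have "\<exists>f. f \<in> N \<and> f \<noteq> \<zero>\<^bsub>T\<^esub>"
    using N(2) N.one_closed by auto
  then obtain f where f: "f \<in> N" "f \<noteq> \<zero>\<^bsub>T\<^esub>"
    and f_least: "\<And>f'. f' \<in> N \<and> f' \<noteq> \<zero>\<^bsub>T\<^esub> \<Longrightarrow> card (supp f) \<le> card (supp f')"
    using ex_has_least_nat[of "\<lambda>f. f \<in> N \<and> f \<noteq> \<zero>\<^bsub>T\<^esub>" _ "\<lambda>f. card (supp f)"] by blast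
  have fT: "f \<in> carrier T" using f NT by auto
  have "\<exists>g\<in>carrier G. f g \<noteq> \<zero>\<^bsub>M\<^esub>"
  proof (rule ccontr)
    assume "\<not> ?thesis"
    then have "f = \<zero>\<^bsub>T\<^esub>"
      using fT by (intro T_ext) auto
    then show False using f by simp
  qed
  then obtain g where g: "g \<in> carrier G" "f g \<noteq> \<zero>\<^bsub>M\<^esub>" by blast
  \<comment> \<open>The translate of \<open>f\<close> by \<open>k\<close> carries the coefficient of
    \<open>f\<close> at \<open>g\<close> to the position \<open>g k\<close>, so the twists that
    appear are those by elements of this set.\<close>
  let ?K = "(\<lambda>k. g \<otimes>\<^bsub>G\<^esub> k) ` carrier G"
  let ?B = "twisted_ann (f g) ?K"
  have fg: "f g \<in> carrier M" and K: "?K \<subseteq> carrier G"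
    using fT g by auto
  have KG: "h \<otimes>\<^bsub>G\<^esub> k \<in> ?K" if "h \<in> ?K" "k \<in> carrier G" for h k
    using that g by (auto simp: G.m_assoc)
  note stable = twisted_ann_stable[OF fg K KG]
  note B = twisted_ann_ideal[OF fg K]
  have inv: "G_invariant R G \<sigma> ?B"
    using stable by (rule G_invariant_of_stable[OF acc surj B])
  have "f g \<star>\<^bsub>M\<^esub> b = \<zero>\<^bsub>M\<^esub>" if b: "b \<in> ?B" for b
  proof -
    have bR: "b \<in> carrier R" using b by (simp add: twisted_ann_def)
    \<comment> \<open>The identity of \<open>G\<close> may be missing from \<open>?K\<close>, so
      \<open>b\<close> is first written as the twist by \<open>g\<close> of some \<open>b'\<close>;
      invariance keeps \<open>b'\<close> in \<open>?B\<close>.\<close>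
    then obtain b' where b': "b' \<in> carrier R" "\<sigma> g b' = b"
      using sigma_surj[OF surj g(1)] by blast
    then have "b' \<in> ?B"
      using inv b g unfolding G_invariant_def by blast
    moreover have "g \<in> ?K"
      using g by (intro image_eqI[of _ _ "\<one>\<^bsub>G\<^esub>"]) auto
    ultimately have "f g \<star>\<^bsub>M\<^esub> (\<one>\<^bsub>R\<^esub> \<otimes>\<^bsub>R\<^esub> \<sigma> g b') = \<zero>\<^bsub>M\<^esub>"
      unfolding twisted_ann_def by blast
    then show ?thesis
      using b' bR by simp
  qed
  then have MB: "x \<star>\<^bsub>M\<^esub> b = \<zero>\<^bsub>M\<^esub>" if "x \<in> carrier M" "b \<in> ?B" for x b
    using id fg g(2) B inv that unfolding idealwise_prime_def by blast
  have coeff: "s h \<in> ?B" if s: "s \<in> ann S T N" and h: "h \<in> carrier G" for s h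
  proof -
    have sS: "s \<in> carrier S" using s by (simp add: ann_def)
    have "f g \<star>\<^bsub>M\<^esub> (r \<otimes>\<^bsub>R\<^esub> \<sigma> (g \<otimes>\<^bsub>G\<^esub> k) (s h)) = \<zero>\<^bsub>M\<^esub>"
      if k: "k \<in> carrier G" and r: "r \<in> carrier R" for k r
    proof -
      let ?f = "f \<star>\<^bsub>T\<^esub> basis k"
      have gk: "g \<otimes>\<^bsub>G\<^esub> k \<in> carrier G" using g k by simp
      have fN: "?f \<in> N" using f k by simp
      have fk: "?f (g \<otimes>\<^bsub>G\<^esub> k) = f g \<star>\<^bsub>M\<^esub> c g k"
      proof -
        \<comment> \<open>Right cancellation leaves only \<open>g\<close> to contribute at the
          position \<open>g k\<close>.\<close>
        have "g' = g \<and> h' = k"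
          if "g' \<in> supp f" "h' \<in> supp_S (basis k)" "g' \<otimes>\<^bsub>G\<^esub> h' = g \<otimes>\<^bsub>G\<^esub> k" for g' h'
          using that supp_S_single[of "\<one>\<^bsub>R\<^esub>" k] unique_product_r_cancel[OF upm, of g' g k] g k
          by (auto simp: supp_def)
        then show ?thesis
          using act_unique[OF fT _ g(1) k, of "basis k"] g k by simp
      qed
      obtain u where u: "u \<in> carrier R" "c g k \<otimes>\<^bsub>R\<^esub> u = \<one>\<^bsub>R\<^esub>"
        using R.Units_r_inv_ex[OF c_unit[OF g(1) k]] by blast
      \<comment> \<open>Chosen so that after twisting by \<open>g k\<close> the factor
        \<open>u\<close> cancels the \<open>c g k\<close> in the coefficient of \<open>?f\<close>,
        leaving the prescribed \<open>r\<close>.\<close>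
      obtain r' where r': "r' \<in> carrier R" "\<sigma> (g \<otimes>\<^bsub>G\<^esub> k) r' = u \<otimes>\<^bsub>R\<^esub> r"
        using sigma_surj[OF surj gk, of "u \<otimes>\<^bsub>R\<^esub> r"] u r by auto
      have "?f \<star>\<^bsub>T\<^esub> cp_single R G (r' \<otimes>\<^bsub>R\<^esub> s h) \<one>\<^bsub>G\<^esub> = \<zero>\<^bsub>T\<^esub>"
      proof (rule minimal_support_annihilates_coefficients[OF upm N(1) fN _ _ sS _ h r'(1)])
        show "?f \<noteq> \<zero>\<^bsub>T\<^esub>"
        proof
          assume "?f = \<zero>\<^bsub>T\<^esub>"
          then have "f g \<star>\<^bsub>M\<^esub> c g k = \<zero>\<^bsub>M\<^esub>"
            using fk gk by simp
          then show False
            using rsmult_unit_eq_zero[OF fg c_unit[OF g(1) k]] g(2) by simp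
        qed
        show "f' = \<zero>\<^bsub>T\<^esub>" if f': "f' \<in> N" "card (supp f') < card (supp ?f)" for f'
        proof -
          \<comment> \<open>The translate has no more nonzero coefficients than \<open>f\<close>, so
            anything smaller is excluded by the choice of \<open>f\<close>.\<close>
          have "card (supp ?f) \<le> card ((\<lambda>g. g \<otimes>\<^bsub>G\<^esub> k) ` supp f)"
            using supp_act_single[OF fT R.one_closed k] fT by (simp add: card_mono)
          also have "\<dots> \<le> card (supp f)"
            using fT by (simp add: card_image_le)
          finally show ?thesis
            using f_least[of f'] f' by fastforce
        qed
        show "(?f \<star>\<^bsub>T\<^esub> cp_single R G r \<one>\<^bsub>G\<^esub>) \<star>\<^bsub>T\<^esub> s = \<zero>\<^bsub>T\<^esub>" if "r \<in> carrier R" for r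
          using s fN that by (simp add: ann_def)
      qed
      then have "?f (g \<otimes>\<^bsub>G\<^esub> k) \<star>\<^bsub>M\<^esub> \<sigma> (g \<otimes>\<^bsub>G\<^esub> k) (r' \<otimes>\<^bsub>R\<^esub> s h) = \<zero>\<^bsub>M\<^esub>"
        using act_scalar[of ?f "r' \<otimes>\<^bsub>R\<^esub> s h" "g \<otimes>\<^bsub>G\<^esub> k"] fT k r' gk sS h by simp
      moreover have "?f (g \<otimes>\<^bsub>G\<^esub> k) \<star>\<^bsub>M\<^esub> \<sigma> (g \<otimes>\<^bsub>G\<^esub> k) (r' \<otimes>\<^bsub>R\<^esub> s h)
          = f g \<star>\<^bsub>M\<^esub> ((c g k \<otimes>\<^bsub>R\<^esub> u) \<otimes>\<^bsub>R\<^esub> (r \<otimes>\<^bsub>R\<^esub> \<sigma> (g \<otimes>\<^bsub>G\<^esub> k) (s h)))"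
        using fg g k gk r r' u(1) sS h by (simp add: fk sigma_mult R.m_assoc flip: rsmult_assoc)
      ultimately show ?thesis
        using u r gk sS h by simp
    qed
    then show ?thesis
      using sS h by (auto simp: twisted_ann_def)
  qed
  show "ann S T N = ann S T (carrier T)"
  proof (intro equalityI subsetI)
    fix s assume s: "s \<in> ann S T N"
    then have sS: "s \<in> carrier S" by (simp add: ann_def)
    have "f' \<star>\<^bsub>T\<^esub> s = \<zero>\<^bsub>T\<^esub>" if f': "f' \<in> carrier T" for f'
    proof (rule T_ext)
      fix k assume k: "k \<in> carrier G"
      \<comment> \<open>Stability keeps each twisted coefficient of \<open>s\<close> in
        \<open>?B\<close>, which kills all of \<open>M\<close>; thus every term of the convolution
        sum vanishes.\<close>
      have "f' g \<star>\<^bsub>M\<^esub> (\<sigma> g (s h) \<otimes>\<^bsub>R\<^esub> c g h) = \<zero>\<^bsub>M\<^esub>" if "g \<in> carrier G" "h \<in> carrier G" for g h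
      proof -
        have "f' g \<star>\<^bsub>M\<^esub> \<sigma> g (s h) = \<zero>\<^bsub>M\<^esub>"
          using MB stable coeff[OF s] f' that by simp
        then show ?thesis
          using f' sS that by (simp add: rsmult_assoc)
      qed
      then show "(f' \<star>\<^bsub>T\<^esub> s) k = \<zero>\<^bsub>T\<^esub> k"
        using k unfolding act_eq[OF f' sS k T_finite[OF f'] S_finite[OF sS] supp_subset order_refl order_refl]
        by (auto intro!: M.add.finprod_one_eqI simp: supp_def supp_S_def)
    qed simp_all
    then show "s \<in> ann S T (carrier T)"
      using sS by (simp add: ann_def)
  qed (use NT in \<open>auto simp: ann_def\<close>)
qed

end

theorem corollary4p12:
  fixes R :: "('r, 'p) ring_scheme" and G :: "('g, 'q) monoid_scheme"
    and \<sigma> :: "'g \<Rightarrow> 'r \<Rightarrow> 'r" and c :: "'g \<Rightarrow> 'g \<Rightarrow> 'r"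
    and M :: "('r, 'm, 'k) module_scheme"
  assumes "unique_product_monoid G"
    and "crossed_system R G \<sigma> c"
    and "right_module R M"
    and "carrier M \<noteq> {\<zero>\<^bsub>M\<^esub>}"
    and "acc_ideals R"
    and "pointwise_surjective R G \<sigma>"
  shows "(S_prime R G \<sigma> c M
      \<longleftrightarrow> (\<forall>m\<in>carrier M. \<forall>b\<in>carrier R.
            (\<forall>h\<in>carrier G. \<forall>r\<in>carrier R. m \<star>\<^bsub>M\<^esub> (r \<otimes>\<^bsub>R\<^esub> \<sigma> h b) = \<zero>\<^bsub>M\<^esub>) \<longrightarrow>
            m = \<zero>\<^bsub>M\<^esub> \<or> (\<forall>x\<in>carrier M. x \<star>\<^bsub>M\<^esub> b = \<zero>\<^bsub>M\<^esub>)))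
    \<and> (S_prime R G \<sigma> c M
      \<longleftrightarrow> (\<forall>m\<in>carrier M. \<forall>B. ideal B R \<and> G_invariant R G \<sigma> B \<and>
            (\<forall>b\<in>B. m \<star>\<^bsub>M\<^esub> b = \<zero>\<^bsub>M\<^esub>) \<longrightarrow>
            m = \<zero>\<^bsub>M\<^esub> \<or> (\<forall>x\<in>carrier M. \<forall>b\<in>B. x \<star>\<^bsub>M\<^esub> b = \<zero>\<^bsub>M\<^esub>)))
    \<and> (S_prime R G \<sigma> c M
      \<longleftrightarrow> (\<forall>N. submodule N R M \<and> N \<noteq> {\<zero>\<^bsub>M\<^esub>} \<longrightarrow>
            G_core R G \<sigma> (ann R M N) = G_core R G \<sigma> (ann R M (carrier M))))"
proof -
  interpret crossed_module R G \<sigma> c M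
    using assms(2,3) by (rule crossed_module.intro)
  \<comment> \<open>The implications form the cycle (1) to (2) to (3) to (1).\<close>
  have el: "S_prime R G \<sigma> c M \<longleftrightarrow> elementwise_prime"
    using S_prime_iff prime_imp_elementwise_prime elementwise_prime_iff_idealwise_prime[OF assms(5,6)]
      idealwise_prime_imp_prime[OF assms(1,5,6,4)] by metis
  have id: "S_prime R G \<sigma> c M \<longleftrightarrow> idealwise_prime"
    unfolding el using assms(5,6) by (rule elementwise_prime_iff_idealwise_prime)
  have core: "S_prime R G \<sigma> c M \<longleftrightarrow> core_prime"
    unfolding el by (rule elementwise_prime_iff_core_prime)
  show ?thesis
    by (intro conjI el[unfolded elementwise_prime_def] id[unfolded idealwise_prime_def]
        core[unfolded core_prime_def])
qed

end
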